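(* Suppose the SBM has order $k_0$ with parameters $(\pi^0,P^0)$. Then, for a penalty function of the form \[ \mathrm{pen}(k,n) = \sum_{i=1}^{k-1}\frac{i(i+2)+3+\epsilon}{2}\log n, \qquad \epsilon>0, \] we have that \[ \hat{k}_{\mathrm{KT}}(\mathbf{x}_{n\times n}) = k_0 \] eventually almost surely as $n\to\infty$.
   Context: Setting: a non-oriented random network on nodes $\{1,\dots,n\}$ with symmetric adjacency matrix $\mathbf{X}_{n\times n}\in\{0,1\}^{n\times n}$ with zero diagonal. In the Stochastic Block Model (SBM) with $k$ communities, latent labels $Z_1,\dots,Z_n$ are i.i.d. on $[k]=\{1,\dots,k\}$ with distribution $\pi=(\pi_1,\dots,\pi_k)$, and, given the labels $\mathbf{z}_n$, the entries $X_{ij}$ ($i<j$) are independent Bernoulli with parameter $P_{z_i,z_j}$, where $P\in[0,1]^{k\times k}$ is symmetric. Thus \[ \mathbb{P}_{\pi,P}(\mathbf{z}_n,\mathbf{x}_{n\times n})=\prod_{a=1}^k\pi_a^{n_a}\prod_{a,b=1}^k P_{a,b}^{O_{a,b}/2}(1-P_{a,b})^{(n_{a,b}-O_{a,b})/2}, \] with $n_a=\#\{i:z_i=a\}$, $n_{a,b}=n_an_b$ for $a\ne b$, $n_{a,a}=n_a(n_a-1)$, $O_{a,b}=\sum_{i,j}\mathbb{1}\{z_i=a,z_j=b\}x_{ij}$. The parameter space is $\Theta^k=\{(\pi,P):\pi\in(0,1]^k,\sum_a\pi_a=1, P\in[0,1]^{k\times k}\text{ symmetric}\}$. The order $k_0$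 of the SBM is the smallest $k$ for which the law can be represented with some $(\pi^0,P^0)\in\Theta^k$ (so $P^0$ has no two identical columns). Both the dense regime ($P^0$ fixed) and the sparse regime ($P^0=\rho_n S^0$ with $S^0$ fixed, $\rho_n\to0$ and $n\rho_n\to\infty$) are allowed. Only the network $\mathbf{x}_{n\times n}$ is observed. The Krichevsky–Trofimov mixture is $\mathrm{KT}_k(\mathbf{x}_{n\times n})=\int_{\Theta^k}\mathbb{P}_{\pi,P}(\mathbf{x}_{n\times n})\,\nu_k(\pi,P)\,d\pi\,dP$, where $\mathbb{P}_{\pi,P}(\mathbf{x}_{n\times n})=\sum_{\mathbf{z}_n\in[k]^n}\mathbb{P}_{\pi,P}(\mathbf{z}_n,\mathbf{x}_{n\times n})$ and $\nu_k$ is the product of a Dirichlet$(1/2,\dots,1/2)$ prior on $\pi$ and independent Beta$(1/2,1/2)$ priors on the entries $P_{a,b}$, $1\le a\le b\le k$. The KT order estimator is \[ \hat{k}_{\mathrm{KT}}(\mathbf{x}_{n\times n})=\arg\max_k\{\log \mathrm{KT}_k(\mathbf{x}_{n\times n})-\mathrm{pen}(k,n)\}, \] with no known upper bound assumed on $k$. *)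

theory Defs
  imports "HOL-Probability.Probability" "HOL-Analysis.Gamma_Function"
begin

text \<open>Networks on nodes 0,...,n-1 are encoded as x :: nat => nat => bool; only the
  entries x i j with i < j < n are read (the matrix is symmetric with zero diagonal).
  Communities are labelled 0,...,k-1. A label vector z is an element of
  {0..<n} -> {0..<k} (extensional).\<close>

definition sbm_complete_lik ::
  "nat \<Rightarrow> (nat \<Rightarrow> real) \<Rightarrow> (nat \<Rightarrow> nat \<Rightarrow> real) \<Rightarrow> (nat \<Rightarrow> nat) \<Rightarrow> (nat \<Rightarrow> nat \<Rightarrow> bool) \<Rightarrow> real" where
  "sbm_complete_lik n \<pi> P z x =
     (\<Prod>i<n. \<pi> (z i)) *
     (\<Prod>(i,j)\<in>{(i,j). i < j \<and> j < n}.
        (if x i j then P (z i) (z j) else 1 - P (z i) (z j)))"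

definition sbm_prob ::
  "nat \<Rightarrow> nat \<Rightarrow> (nat \<Rightarrow> real) \<Rightarrow> (nat \<Rightarrow> nat \<Rightarrow> real) \<Rightarrow> (nat \<Rightarrow> nat \<Rightarrow> bool) \<Rightarrow> real" where
  "sbm_prob n k \<pi> P x = (\<Sum>z\<in>{0..<n} \<rightarrow>\<^sub>E {0..<k}. sbm_complete_lik n \<pi> P z x)"

definition pi_of :: "nat \<Rightarrow> (nat \<Rightarrow> real) \<Rightarrow> nat \<Rightarrow> real" where
  "pi_of k u a = (if a + 1 < k then u a else 1 - (\<Sum>b<k - 1. u b))"

text \<open>Dirichlet(1/2,...,1/2) density w.r.t. Lebesgue measure on the first k-1 coordinates.\<close>
definition dirichlet_half_density :: "nat \<Rightarrow> (nat \<Rightarrow> real) \<Rightarrow> real" where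
  "dirichlet_half_density k u =
     (if (\<forall>a<k. 0 < pi_of k u a)
      then Gamma (real k / 2) / Gamma (1/2) ^ k * (\<Prod>a<k. pi_of k u a powr (-1/2))
      else 0)"

definition pair_idx :: "nat \<Rightarrow> (nat \<times> nat) set" where
  "pair_idx k = {(a,b). a \<le> b \<and> b < k}"

definition P_of :: "(nat \<times> nat \<Rightarrow> real) \<Rightarrow> nat \<Rightarrow> nat \<Rightarrow> real" where
  "P_of v a b = v (min a b, max a b)"

text \<open>Product of Beta(1/2,1/2) densities (B(1/2,1/2) = pi).\<close>
definition beta_half_density :: "nat \<Rightarrow> (nat \<times> nat \<Rightarrow> real) \<Rightarrow> real" where
  "beta_half_density k v =
     (\<Prod>p\<in>pair_idx k.
        (if 0 < v p \<and> v p < 1 then (v p) powr (-1/2) * (1 - v p) powr (-1/2) / pi else 0))"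

definition KT :: "nat \<Rightarrow> nat \<Rightarrow> (nat \<Rightarrow> nat \<Rightarrow> bool) \<Rightarrow> real" where
  "KT n k x = enn2real
     (\<integral>\<^sup>+ u. (\<integral>\<^sup>+ v.
        ennreal (dirichlet_half_density k u * beta_half_density k v *
                 sbm_prob n k (pi_of k u) (P_of v) x)
      \<partial>(PiM (pair_idx k) (\<lambda>_. lborel)))
      \<partial>(PiM {..<k - 1} (\<lambda>_. lborel)))"

definition pen :: "real \<Rightarrow> nat \<Rightarrow> nat \<Rightarrow> real" where
  "pen \<epsilon> k n = (\<Sum>i=1..k-1. (real i * (real i + 2) + 3 + \<epsilon>) / 2 * ln (real n))"

definition KT_crit :: "real \<Rightarrow> nat \<Rightarrow> (nat \<Rightarrow> nat \<Rightarrow> bool) \<Rightarrow> nat \<Rightarrow> real" where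
  "KT_crit \<epsilon> n x k = ln (KT n k x) - pen \<epsilon> k n"

definition k_KT :: "real \<Rightarrow> nat \<Rightarrow> (nat \<Rightarrow> nat \<Rightarrow> bool) \<Rightarrow> nat" where
  "k_KT \<epsilon> n x = (LEAST k. 1 \<le> k \<and> (\<forall>k'\<ge>1. KT_crit \<epsilon> n x k' \<le> KT_crit \<epsilon> n x k))"

end

theory Submission
  imports Defs
begin

text \<open>
  Only the law of each network is prescribed, not their joint law, so everything reduces to
  Borel--Cantelli: the probabilities of the events that some \<open>k \<noteq> k0\<close> beats \<open>k0\<close> must be summable.
  Conjugacy and Stirling-type bounds on the Gamma function show that \<open>KT n k0\<close> dominates the true
  likelihood up to a factor of order \<open>n\<close> to the power \<open>(k0 (k0 + 2) - 1) / 2\<close>.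

  \<^emph>\<open>Overestimation.\<close> If \<open>k > k0\<close> wins, the true likelihood is at most \<open>n\<close> to the power
  \<open>- 2 - (k - k0 - 1)\<close> times a constant times \<open>KT n k\<close>. Since \<open>KT n k\<close> is a probability distribution
  on networks, summation over the networks and over all \<open>k > k0\<close> gives a bound of order \<open>1 / n\<^sup>2\<close>.

  \<^emph>\<open>Underestimation.\<close> If \<open>k < k0\<close> wins, the true likelihood is at most polynomially larger than
  \<open>KT n k\<close>, which in turn is at most the sum of the likelihoods over all labellings and over the
  polynomially many possible values of the maximum likelihood estimator. The probability of this event
  is therefore bounded by a sum of exponentially many Hellinger affinities of product Bernoulli measures.
  By the pigeonhole principle two true communities share a fitted label on cells of linear size,
  so for typical true labels every affinity is at most \<open>exp (- c \<rho> n\<^sup>2)\<close>, which beats the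
  exponential number of terms because \<open>n \<rho>\<close> tends to infinity.
\<close>

section \<open>Stirling-type and Gibbs inequalities\<close>

text \<open>Square roots of edge probabilities carry the sparse regime: the square of
  \<open>sqrt (\<rho> * s) - sqrt (\<rho> * t)\<close> is linear in \<rho>, whereas that of
  \<open>\<rho> * s - \<rho> * t\<close> is quadratic. Hence the growth of \<open>n * \<rho>\<close>
  alone lets the exponent beat \<open>(k0 * k) ^ n\<close>, although the fitted parameters are not
  scaled by \<rho>. An affinity compares two product measures, while the mixture is an integral over
  a continuum of them. A block holds fewer than \<open>n^2\<close> pairs, so each maximum likelihood
  value is a fraction from a finite grid of polynomial size that does not depend on the network. A
  sum over that grid replaces the integral and can be exchanged with the sum over networks. The
  penalty is tuned to the lower bound on the mixture: its increment from \<open>k0\<close> to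
  \<open>k0 + 1\<close> exceeds the exponent lost there by \<open>2 + \<epsilon> / 2\<close>, and
  each later increment is at least 1. The former yields \<open>1 / n^2\<close>, the latter turns the
  union over unboundedly many orders into a geometric series. The lower bound must therefore have
  the exact power of \<open>n\<close>, so the Gamma estimates may lose constants only.\<close>

lemma entropy_difference_le:
  fixes t :: real
  assumes "0 \<le> t" "t < 1"
  shows "(1 + t) * ln (1 + t) - (1 - t) * ln (1 - t) \<le> 2 * t"
proof -
  let ?g = "\<lambda>t::real. (1 + t) * ln (1 + t) - (1 - t) * ln (1 - t) - 2 * t"
  have "?g t \<le> ?g 0"
  proof (rule DERIV_nonpos_imp_nonincreasing[OF assms(1)])
    fix x :: real assume x: "0 \<le> x" "x \<le> t"
    hence x1: "x < 1" using assms by simp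
    have "(?g has_real_derivative (ln (1 + x) + ln (1 - x))) (at x)"
      using x x1 by (auto intro!: derivative_eq_intros simp: divide_inverse)
    moreover have "ln (1 + x) + ln (1 - x) \<le> 0"
    proof -
      have "ln (1 + x) + ln (1 - x) = ln ((1 + x) * (1 - x))"
        using x x1 by (subst ln_mult) auto
      also have "(1 + x) * (1 - x) = 1 - x^2" by (simp add: power2_eq_square algebra_simps)
      also have "ln (1 - x^2) \<le> 0"
        using x x1 by (subst ln_le_zero_iff) (auto simp: abs_square_less_1 power_less_one_iff)
      finally show ?thesis .
    qed
    ultimately show "\<exists>y. (?g has_real_derivative y) (at x) \<and> y \<le> 0" by blast
  qed
  thus ?thesis by simp
qed

text \<open>The gap between the sides has derivative \<open>2 / (1 - x * x) - 2\<close>. At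
  \<open>t = 1 / (2 * n + 1)\<close> this drives the induction for the factorial bound, just as
  \<open>entropy_difference_le\<close>, whose gap has derivative \<open>ln (1 - x^2)\<close>, drives
  the one for the lower Gamma bound.\<close>

lemma ln_ratio_ge:
  fixes t :: real
  assumes "0 \<le> t" "t < 1"
  shows "2 * t \<le> ln (1 + t) - ln (1 - t)"
proof -
  let ?g = "\<lambda>t::real. ln (1 + t) - ln (1 - t) - 2 * t"
  have "?g 0 \<le> ?g t"
  proof (rule DERIV_nonneg_imp_nondecreasing[OF assms(1)])
    fix x :: real assume x: "0 \<le> x" "x \<le> t"
    hence x1: "x < 1" using assms by simp
    have "(?g has_real_derivative (1 / (1 + x) + 1 / (1 - x) - 2)) (at x)"
      using x x1 by (auto intro!: derivative_eq_intros simp: divide_inverse)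
    moreover have "1 / (1 + x) + 1 / (1 - x) - 2 \<ge> 0"
    proof -
      have "x * x < 1" using x x1 mult_left_le[of x x] by linarith
      moreover have "1 / (1 + x) + 1 / (1 - x) = 2 / (1 - x * x)"
        using x x1 calculation by (simp add: divide_simps) (simp add: algebra_simps)
      ultimately show ?thesis by (simp add: pos_le_divide_eq)
    qed
    ultimately show "\<exists>y. (?g has_real_derivative y) (at x) \<and> 0 \<le> y" by blast
  qed
  thus ?thesis by simp
qed

text \<open>Measured against their midpoint, \<open>m + 1\<close> and \<open>m\<close> become the
  symmetric pair \<open>1 + t\<close> and \<open>1 - t\<close>, the form that the two preceding
  inequalities need.\<close>

lemma ln_half_shift:
  fixes m :: real
  assumes "0 < m"
  shows "ln (1 + 1 / (2 * m + 1)) = ln (m + 1) - ln (m + 1/2)"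
    and "ln (1 - 1 / (2 * m + 1)) = ln m - ln (m + 1/2)"
proof -
  have "1 + 1 / (2 * m + 1) = (m + 1) / (m + 1/2)" "1 - 1 / (2 * m + 1) = m / (m + 1/2)"
    using assms by (simp_all add: divide_simps) (simp_all add: algebra_simps)
  thus "ln (1 + 1 / (2 * m + 1)) = ln (m + 1) - ln (m + 1/2)"
    and "ln (1 - 1 / (2 * m + 1)) = ln m - ln (m + 1/2)"
    using assms by (simp_all add: ln_div)
qed

text \<open>At half-integers Stirling's formula has no factor \<open>sqrt m\<close>, so
  \<open>m ^ m * exp (- m)\<close> is the exact order. The constant
  \<open>sqrt pi = Gamma (1/2)\<close> gives equality at \<open>m = 0\<close>, where
  \<open>0 ^ 0 = 1\<close>, and later cancels against the Dirichlet normalisation.\<close>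

lemma Gamma_half_lower:
  "sqrt pi * real m ^ m * exp (- real m) \<le> Gamma (real m + 1/2)"
proof (induction m)
  case 0
  show ?case using Gamma_one_half_real by simp
next
  case (Suc m)
  have G: "Gamma (real (Suc m) + 1/2) = (real m + 1/2) * Gamma (real m + 1/2)"
  proof -
    have "real m + 1/2 \<notin> \<int>\<^sub>\<le>\<^sub>0" by (auto dest: nonpos_Ints_nonpos)
    thus ?thesis using Gamma_plus1[of "real m + 1/2"] by (simp add: add_ac)
  qed
  \<comment> \<open>The ratio of consecutive lower bounds must not exceed the factor
    \<open>m + 1/2\<close> of the Gamma recursion. In logarithms this is
    \<open>entropy_difference_le\<close> multiplied by \<open>m + 1/2\<close>.\<close>
  have key: "real (Suc m) ^ Suc m \<le> exp 1 * (real m + 1/2) * real m ^ m"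
  proof (cases "m = 0")
    case True
    thus ?thesis using exp_ge_add_one_self[of 1] by simp
  next
    case False
    define t where "t = 1 / (2 * real m + 1)"
    have t: "0 \<le> t" "t < 1" using False by (auto simp: t_def)
    have l: "ln (1 + t) = ln (real m + 1) - ln (real m + 1/2)" "ln (1 - t) = ln (real m) - ln (real m + 1/2)"
      unfolding t_def using False by (auto intro!: ln_half_shift)
    have "(real m + 1/2) * ((1 + t) * ln (1 + t) - (1 - t) * ln (1 - t)) \<le> (real m + 1/2) * (2 * t)"
      by (intro mult_left_mono entropy_difference_le t) auto
    moreover have e: "(real m + 1/2) * (2 * t) = 1" "(real m + 1/2) * (1 + t) = real m + 1"
      "(real m + 1/2) * (1 - t) = real m"
      by (simp_all add: t_def field_simps)
    moreover have "(real m + 1/2) * ((1 + t) * ln (1 + t) - (1 - t) * ln (1 - t))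
        = (real m + 1) * ln (1 + t) - real m * ln (1 - t)"
      unfolding right_diff_distrib mult.assoc[symmetric] e(2) by (simp only: e(3) flip: right_diff_distrib)
    ultimately have "(real m + 1) * ln (1 + t) - real m * ln (1 - t) \<le> 1"
      by linarith
    hence "(real m + 1) * ln (real m + 1) \<le> 1 + ln (real m + 1/2) + real m * ln (real m)"
      unfolding l by (simp add: algebra_simps)
    hence "exp (real (Suc m) * ln (real (Suc m))) \<le> exp (1 + ln (real m + 1/2) + real m * ln (real m))"
      by (simp add: add_ac)
    moreover have "exp (real (Suc m) * ln (real (Suc m))) = real (Suc m) ^ Suc m"
      by (subst exp_of_nat_mult) simp
    moreover have "exp (1 + ln (real m + 1/2) + real m * ln (real m))
        = exp 1 * (real m + 1/2) * real m ^ m"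
      using False by (simp add: exp_add exp_of_nat_mult)
    ultimately show ?thesis by simp
  qed
  have "sqrt pi * real (Suc m) ^ Suc m * exp (- real (Suc m))
      \<le> sqrt pi * (exp 1 * (real m + 1/2) * real m ^ m) * exp (- real (Suc m))"
    by (intro mult_right_mono mult_left_mono key) auto
  also have "\<dots> = (real m + 1/2) * (sqrt pi * real m ^ m * exp (- real m))"
    by (simp add: exp_diff exp_minus field_simps exp_add)
  also have "\<dots> \<le> (real m + 1/2) * Gamma (real m + 1/2)"
    by (intro mult_left_mono Suc.IH) auto
  finally show ?case by (simp only: G)
qed

text \<open>Stirling's formula with \<open>exp 1\<close> in place of \<open>sqrt (2 * pi)\<close>:
  the case \<open>n = 1\<close> becomes an equality and the induction step on logarithms is
  \<open>ln_ratio_ge\<close>.\<close>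

lemma fact_upper:
  assumes "1 \<le> n"
  shows "fact n \<le> exp 1 * sqrt (real n) * real n ^ n * exp (- real n)"
proof -
  have "ln (fact n :: real) \<le> 1 + ln (real n) / 2 + real n * ln (real n) - real n"
    using assms
  proof (induction n rule: dec_induct)
    case base
    show ?case by simp
  next
    case (step n)
    define t where "t = 1 / (2 * real n + 1)"
    have n0: "0 < real n" using step.hyps by simp
    have t: "0 \<le> t" "t < 1" using n0 by (auto simp: t_def)
    have l: "ln (1 + t) = ln (real n + 1) - ln (real n + 1/2)" "ln (1 - t) = ln (real n) - ln (real n + 1/2)"
      unfolding t_def using n0 by (auto intro!: ln_half_shift)
    have "(real n + 1/2) * (2 * t) \<le> (real n + 1/2) * (ln (1 + t) - ln (1 - t))"
      by (intro mult_left_mono ln_ratio_ge t) auto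
    moreover have "(real n + 1/2) * (2 * t) = 1" by (simp add: t_def field_simps)
    ultimately have "1 \<le> (real n + 1/2) * (ln (real n + 1) - ln (real n))"
      unfolding l by simp
    hence "ln (real n + 1) + (1 + ln (real n) / 2 + real n * ln (real n) - real n)
       \<le> 1 + ln (real n + 1) / 2 + (real n + 1) * ln (real n + 1) - (real n + 1)"
      by (simp add: algebra_simps)
    moreover have "ln (fact (Suc n) :: real) = ln (real n + 1) + ln (fact n)"
      by (simp add: ln_mult add_ac)
    ultimately show ?case using step.IH by (simp add: add_ac)
  qed
  hence "exp (ln (fact n :: real)) \<le> exp (1 + ln (real n) / 2 + real n * ln (real n) - real n)"
    by (subst exp_le_cancel_iff)
  also have "\<dots> = exp 1 * sqrt (real n) * real n ^ n * exp (- real n)"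
  proof -
    have "exp (ln (real n) / 2) = sqrt (real n)"
      using assms by (simp flip: ln_sqrt)
    moreover have "exp (real n * ln (real n)) = real n ^ n"
      using assms by (subst exp_of_nat_mult) simp
    moreover have "exp (1 + ln (real n) / 2 + real n * ln (real n) - real n)
        = exp 1 * exp (ln (real n) / 2) * exp (real n * ln (real n)) * exp (- real n)"
      by (simp flip: exp_add)
    ultimately show ?thesis by simp
  qed
  finally show ?thesis by simp
qed

text \<open>Log-convexity at the midpoint of \<open>y\<close> and \<open>y + 1\<close>, combined
  with \<open>Gamma (y + 1) = y * Gamma y\<close>.\<close>

lemma Gamma_add_half_le:
  fixes y :: real
  assumes "0 < y"
  shows "Gamma (y + 1/2) \<le> sqrt y * Gamma y"
proof -
  have "(ln \<circ> Gamma) ((1 - 1/2) *\<^sub>R y + (1/2) *\<^sub>R (y + 1))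
      \<le> (1 - 1/2) * (ln \<circ> Gamma) y + (1/2) * (ln \<circ> Gamma) (y + 1)"
    by (rule convex_onD[OF log_convex_Gamma_real]) (use assms in auto)
  moreover have "(1 - 1/2) *\<^sub>R y + (1/2) *\<^sub>R (y + 1) = y + 1/2" by (simp add: field_simps)
  moreover have "Gamma (y + 1) = y * Gamma y"
    using assms by (intro Gamma_plus1) (auto dest: nonpos_Ints_nonpos)
  moreover have "Gamma y \<noteq> 0" using Gamma_real_pos[OF assms] by linarith
  ultimately have "ln (Gamma (y + 1/2)) \<le> ln (Gamma y) + ln y / 2"
    using assms by (simp add: ln_mult field_simps)
  hence "exp (ln (Gamma (y + 1/2))) \<le> exp (ln (Gamma y) + ln y / 2)" by simp
  thus ?thesis using assms by (simp add: exp_add mult.commute flip: ln_sqrt)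
qed

text \<open>The argument is reached from \<open>n + 1/2\<close> by \<open>k\<close> half steps, each
  at the price of one square root. The base loses no power of \<open>n\<close>: the root in
  \<open>fact_upper\<close> and that of the half step from \<open>n\<close> cancel the division in
  \<open>Gamma n = fact n / n\<close>.\<close>

lemma Gamma_half_integer_upper:
  assumes "1 \<le> n"
  shows "Gamma (real n + (real k + 1) / 2)
    \<le> exp 1 * real n ^ n * exp (- real n) * sqrt (real n + real k) ^ k"
proof (induction k)
  case 0
  have "Gamma (real n + 1/2) \<le> sqrt (real n) * Gamma (real n)"
    using assms by (intro Gamma_add_half_le) auto
  also have "Gamma (real n) = fact n / real n"
    using assms Gamma_fact[of "n - 1", where ?'a = real] by (cases n) (auto simp: add_ac)
  also have "sqrt (real n) * (fact n / real n)
      \<le> sqrt (real n) * ((exp 1 * sqrt (real n) * real n ^ n * exp (- real n)) / real n)"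
    using assms by (intro mult_left_mono divide_right_mono fact_upper) auto
  also have "\<dots> = (sqrt (real n) * sqrt (real n)) / real n * (exp 1 * real n ^ n * exp (- real n))"
    by (simp only: times_divide_eq_right times_divide_eq_left mult_ac)
  also have "\<dots> = exp 1 * real n ^ n * exp (- real n)" using assms by simp
  finally show ?case by simp
next
  case (Suc k)
  let ?y = "real n + (real k + 1) / 2"
  have "Gamma (real n + (real (Suc k) + 1) / 2) = Gamma (?y + 1/2)"
    by (simp add: field_simps)
  also have "\<dots> \<le> sqrt ?y * Gamma ?y"
    by (intro Gamma_add_half_le) (simp add: add_nonneg_pos)
  also have "\<dots> \<le> sqrt (real n + real (Suc k)) *
      (exp 1 * real n ^ n * exp (- real n) * sqrt (real n + real (Suc k)) ^ k)"
  proof (intro mult_mono)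
    show "sqrt ?y \<le> sqrt (real n + real (Suc k))" by simp
    show "Gamma ?y \<le> exp 1 * real n ^ n * exp (- real n) * sqrt (real n + real (Suc k)) ^ k"
      by (rule order.trans[OF Suc.IH]) (intro mult_left_mono power_mono, auto)
  qed (auto intro!: Gamma_real_nonneg add_nonneg_pos)
  finally show ?case by (simp add: mult_ac)
qed

section \<open>Likelihoods against their Dirichlet and Beta averages\<close>

text \<open>Gibbs' inequality in multiplicative form: the frequencies \<open>N a / n\<close>
  maximise the multinomial likelihood. Each factor uses \<open>x \<le> exp (x - 1)\<close> at
  \<open>x = p a * n / N a\<close>, and the exponents add up to zero.\<close>

lemma Gibbs_power:
  fixes p :: "'a \<Rightarrow> real" and N :: "'a \<Rightarrow> nat"
  assumes "finite I" "\<And>a. a \<in> I \<Longrightarrow> 0 \<le> p a" "(\<Sum>a\<in>I. p a) = 1"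
  defines "n \<equiv> (\<Sum>a\<in>I. N a)"
  shows "(\<Prod>a\<in>I. p a ^ N a) * real n ^ n \<le> (\<Prod>a\<in>I. real (N a) ^ N a)"
proof -
  have *: "(p a * real n) ^ N a \<le> real (N a) ^ N a * exp (p a * real n - real (N a))"
    if a: "a \<in> I" for a
  proof (cases "N a = 0")
    case True
    thus ?thesis using assms(2)[OF a] by simp
  next
    case False
    let ?x = "p a * real n / real (N a)"
    have "?x ^ N a \<le> exp (?x - 1) ^ N a"
      using assms(2)[OF a] exp_ge_add_one_self[of "?x - 1"] by (intro power_mono) auto
    also have "\<dots> = exp (p a * real n - real (N a))"
      using False by (simp flip: exp_of_nat_mult add: field_simps)
    finally show ?thesis using False by (simp add: power_divide field_simps)
  qed
  have "(\<Prod>a\<in>I. p a ^ N a) * real n ^ n = (\<Prod>a\<in>I. (p a * real n) ^ N a)"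
    by (simp add: n_def power_mult_distrib prod.distrib power_sum)
  also have "\<dots> \<le> (\<Prod>a\<in>I. real (N a) ^ N a * exp (p a * real n - real (N a)))"
    by (intro prod_mono conjI * zero_le_power mult_nonneg_nonneg) (use assms(2) in auto)
  also have "\<dots> = (\<Prod>a\<in>I. real (N a) ^ N a) * exp (\<Sum>a\<in>I. p a * real n - real (N a))"
    using assms(1) by (simp add: prod.distrib exp_sum)
  also have "(\<Sum>a\<in>I. p a * real n - real (N a)) = 0"
    using assms(3) by (simp add: sum_subtractf n_def flip: sum_distrib_right)
  finally show ?thesis by simp
qed

text \<open>\<open>Gibbs_power\<close> with two outcomes. An empty block divides by zero, but then
  both sides are empty powers.\<close>

lemma binomial_likelihood_le_MLE:
  fixes v :: real and o0 o1 :: nat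
  assumes "0 \<le> v" "v \<le> 1"
  defines "m \<equiv> real (o1 + o0)"
  shows "v ^ o1 * (1 - v) ^ o0 \<le> (real o1 / m) ^ o1 * (1 - real o1 / m) ^ o0"
proof (cases "o1 + o0 = 0")
  case True
  thus ?thesis by simp
next
  case False
  hence m: "m > 0" unfolding m_def by (subst of_nat_0_less_iff) simp
  have "(\<Prod>b\<in>UNIV. (if b then v else 1 - v) ^ (if b then o1 else o0)) *
      real (\<Sum>b\<in>UNIV. if b then o1 else o0) ^ (\<Sum>b\<in>UNIV. if b then o1 else o0)
      \<le> (\<Prod>b\<in>UNIV. real (if b then o1 else o0) ^ (if b then o1 else o0))"
    using assms by (intro Gibbs_power) (auto simp: UNIV_bool)
  hence "v ^ o1 * (1 - v) ^ o0 * m ^ (o0 + o1) \<le> real o1 ^ o1 * real o0 ^ o0"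
    by (simp add: UNIV_bool m_def add.commute mult.commute)
  hence "v ^ o1 * (1 - v) ^ o0 \<le> (real o1 / m) ^ o1 * (real o0 / m) ^ o0"
    using m by (simp add: power_divide power_add field_simps)
  also have "real o0 / m = 1 - real o1 / m" using m by (simp add: m_def field_simps)
  finally show ?thesis .
qed

text \<open>The Krichevsky--Trofimov regret bound: \<open>n ^ n\<close>, \<open>exp (- n)\<close>
  and \<open>sqrt pi ^ k\<close> cancel between numerator and denominator, leaving one factor of
  order \<open>sqrt n\<close> per free weight.\<close>

lemma Dirichlet_half_moment_lower:
  fixes p :: "nat \<Rightarrow> real" and N :: "nat \<Rightarrow> nat"
  assumes "1 \<le> k" "\<And>a. a < k \<Longrightarrow> 0 \<le> p a" "(\<Sum>a<k. p a) = 1" "(\<Sum>a<k. N a) = n" "1 \<le> n"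
  shows "(\<Prod>a<k. p a ^ N a) / (exp 1 * sqrt (real n + real (k - 1)) ^ (k - 1))
    \<le> (\<Prod>a<k. Gamma (real (N a) + 1/2)) / (Gamma (1/2) ^ k * Gamma (real n + real k / 2))"
proof -
  let ?S = "sqrt (real n + real (k - 1)) ^ (k - 1)"
  have S: "?S > 0" using assms(5) by (intro zero_less_power) auto
  have e: "(\<Prod>a<k. exp (- real (N a))) = exp (- real n)"
    using assms(4) by (subst exp_sum[symmetric]) (auto simp: sum_negf)
  have "(\<Prod>a<k. p a ^ N a) * real n ^ n * (sqrt pi ^ k * exp (- real n))
     \<le> (\<Prod>a<k. real (N a) ^ N a) * (sqrt pi ^ k * exp (- real n))"
    using Gibbs_power[of "{..<k}" p N] assms by (intro mult_right_mono) auto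
  also have "\<dots> = (\<Prod>a<k. sqrt pi * real (N a) ^ N a * exp (- real (N a)))"
    by (simp add: prod.distrib e)
  also have "\<dots> \<le> (\<Prod>a<k. Gamma (real (N a) + 1/2))"
    by (intro prod_mono conjI Gamma_half_lower) auto
  finally have 1: "(\<Prod>a<k. p a ^ N a) * real n ^ n * (sqrt pi ^ k * exp (- real n))
      \<le> (\<Prod>a<k. Gamma (real (N a) + 1/2))" .
  \<comment> \<open>\<open>n + k / 2\<close> lies \<open>k - 1\<close> half steps beyond
    \<open>n + 1/2\<close>, as many as the simplex has dimensions.\<close>
  have "Gamma (real n + real k / 2) \<le> exp 1 * real n ^ n * exp (- real n) * ?S"
    using Gamma_half_integer_upper[OF assms(5), of "k - 1"] assms(1) by (simp add: of_nat_diff)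
  hence 2: "sqrt pi ^ k * Gamma (real n + real k / 2) \<le> sqrt pi ^ k * (exp 1 * real n ^ n * exp (- real n) * ?S)"
    by (intro mult_left_mono) auto
  have "(\<Prod>a<k. p a ^ N a) / (exp 1 * ?S)
      = ((\<Prod>a<k. p a ^ N a) * real n ^ n * (sqrt pi ^ k * exp (- real n)))
        / (sqrt pi ^ k * (exp 1 * real n ^ n * exp (- real n) * ?S))"
    using assms(5) S by (simp add: field_simps)
  also have "\<dots> \<le> (\<Prod>a<k. Gamma (real (N a) + 1/2)) / (sqrt pi ^ k * Gamma (real n + real k / 2))"
    using assms 1 2 by (intro frac_le) (auto intro!: prod_nonneg mult_pos_pos Gamma_real_pos Gamma_real_nonneg)
  finally show ?thesis by (simp add: Gamma_one_half_real)
qed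

text \<open>The Dirichlet bound with two labels. A block holds fewer than \<open>n^2\<close> pairs,
  so a block parameter costs a factor \<open>n\<close>, twice the exponent of a label weight; the
  strict inequality absorbs the \<open>+ 1\<close> under the root.\<close>

lemma Beta_half_moment_lower:
  fixes p :: real
  assumes "0 \<le> p" "p \<le> 1" "o1 + o0 < n\<^sup>2" "1 \<le> n"
  shows "p ^ o1 * (1 - p) ^ o0 / (exp 1 * real n) \<le> Beta (real o1 + 1/2) (real o0 + 1/2) / pi"
proof (cases "o1 + o0 = 0")
  case True
  have "1 \<le> exp 1 * real n"
    using assms(4) exp_ge_add_one_self[of 1] by (intro mult_ge1_I) auto
  thus ?thesis using True by (simp add: Beta_def Gamma_one_half_real)
next
  case False
  let ?m = "o1 + o0"
  have "(\<Prod>a<2::nat. (if a = 0 then p else 1 - p) ^ (if a = 0 then o1 else o0)) /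
        (exp 1 * sqrt (real ?m + real (2 - 1)) ^ (2 - 1))
    \<le> (\<Prod>a<2::nat. Gamma (real (if a = 0 then o1 else o0) + 1/2)) /
        (Gamma (1/2) ^ 2 * Gamma (real ?m + real 2 / 2))"
    using assms False
    by (intro Dirichlet_half_moment_lower[where n = "o1 + o0"]) (auto simp: numeral_2_eq_2)
  hence A: "p ^ o1 * (1 - p) ^ o0 / (exp 1 * sqrt (real ?m + 1))
     \<le> Beta (real o1 + 1/2) (real o0 + 1/2) / pi"
    by (simp add: numeral_2_eq_2 Beta_def Gamma_one_half_real add_ac) (simp add: mult.commute)
  have "real (o1 + o0 + 1) \<le> real (n\<^sup>2)"
    using assms(3) by (intro of_nat_mono) simp
  hence "sqrt (real ?m + 1) \<le> sqrt ((real n)\<^sup>2)"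
    by (intro real_sqrt_le_mono) (simp add: add_ac)
  hence "sqrt (real ?m + 1) \<le> real n" by simp
  hence "p ^ o1 * (1 - p) ^ o0 / (exp 1 * real n)
      \<le> p ^ o1 * (1 - p) ^ o0 / (exp 1 * sqrt (real ?m + 1))"
    using assms by (intro divide_left_mono mult_left_mono mult_pos_pos) auto
  thus ?thesis using A by linarith
qed

section \<open>Dirichlet and Beta integrals\<close>

text \<open>One step of the Dirichlet integral: a mass \<open>s\<close> is split between two labels,
  and \<open>y = s * x\<close> reduces this to the unit interval. For \<open>s \<le> 0\<close> there
  is nothing to split and both sides vanish.\<close>

lemma nn_integral_Beta_scaled:
  fixes a b s :: real
  assumes "0 < a" "0 < b"
  shows "(\<integral>\<^sup>+ y. ennreal (if 0 < y \<and> 0 < s - y then y powr (a - 1) * (s - y) powr (b - 1) else 0) \<partial>lborel)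
    = ennreal (if 0 < s then s powr (a + b - 1) * Beta a b else 0)"
proof (cases "0 < s")
  case False
  hence "(\<integral>\<^sup>+ y. ennreal (if 0 < y \<and> 0 < s - y then y powr (a - 1) * (s - y) powr (b - 1) else 0) \<partial>lborel)
    = (\<integral>\<^sup>+ (y::real). 0 \<partial>lborel)"
    by (intro nn_integral_cong) auto
  thus ?thesis using False by simp
next
  case True
  let ?f = "\<lambda>y. ennreal (if 0 < y \<and> 0 < s - y then y powr (a - 1) * (s - y) powr (b - 1) else 0)"
  have B: "(\<integral>\<^sup>+ x. ennreal (x powr (a - 1) * (1 - x) powr (b - 1)) * indicator {0<..<1} x \<partial>lborel)
      = ennreal (Beta a b)"
    using has_integral_Beta_real[OF assms]
    by (intro nn_integral_has_integral_lebesgue') (auto simp: has_integral_Icc_iff_Ioo)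
  have "(\<integral>\<^sup>+ y. ?f y \<partial>lborel) = ennreal \<bar>s\<bar> * (\<integral>\<^sup>+ x. ?f (0 + s * x) \<partial>lborel)"
    using True by (intro nn_integral_real_affine) auto
  also have "(\<integral>\<^sup>+ x. ?f (0 + s * x) \<partial>lborel) = (\<integral>\<^sup>+ x. ennreal (s powr (a + b - 2)) *
     (ennreal (x powr (a - 1) * (1 - x) powr (b - 1)) * indicator {0<..<1} x) \<partial>lborel)"
  proof (intro nn_integral_cong)
    fix x :: real
    have s: "s - s * x = s * (1 - x)" by (simp add: algebra_simps)
    show "?f (0 + s * x) = ennreal (s powr (a + b - 2)) *
       (ennreal (x powr (a - 1) * (1 - x) powr (b - 1)) * indicator {0<..<1} x)"
    proof (cases "0 < x \<and> x < 1")
      case x: True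
      have "(s * x) powr (a - 1) * (s * (1 - x)) powr (b - 1)
          = (s powr (a - 1) * s powr (b - 1)) * (x powr (a - 1) * (1 - x) powr (b - 1))"
        using x True by (simp add: powr_mult)
      also have "s powr (a - 1) * s powr (b - 1) = s powr (a + b - 2)"
        by (simp flip: powr_add)
      finally show ?thesis using x True by (simp add: s ennreal_mult')
    next
      case False
      thus ?thesis using True by (auto simp: s zero_less_mult_iff)
    qed
  qed
  also have "\<dots> = ennreal (s powr (a + b - 2)) * ennreal (Beta a b)"
    by (subst nn_integral_cmult) (auto simp: B)
  also have "ennreal \<bar>s\<bar> * \<dots> = ennreal (s * s powr (a + b - 2) * Beta a b)"
    using True by (simp add: ennreal_mult' mult.assoc)
  also have "s * s powr (a + b - 2) = s powr (a + b - 1)"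
    using True powr_add[of s 1 "a + b - 2"] by simp
  finally show ?thesis using True by simp
qed

lemma measurable_pi_of [measurable]:
  assumes "1 \<le> k"
  shows "(\<lambda>u. pi_of k u a) \<in> borel_measurable (PiM {..<k - 1} (\<lambda>_. lborel))"
proof (cases "a + 1 < k")
  case True
  hence "a \<in> {..<k - 1}" by auto
  hence [measurable]: "(\<lambda>u. u a) \<in> borel_measurable (PiM {..<k - 1} (\<lambda>_. lborel :: real measure))"
    using measurable_component_singleton[of a "{..<k - 1}" "\<lambda>_. lborel :: real measure"] by simp
  have "(\<lambda>u. pi_of k u a) = (\<lambda>u. u a)" using True by (simp add: pi_of_def)
  thus ?thesis by (simp only:) measurable
next
  case False
  have "(\<lambda>u. u b) \<in> borel_measurable (PiM {..<k - 1} (\<lambda>_. lborel :: real measure))"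
    if "b \<in> {..<k - 1}" for b
    using measurable_component_singleton[OF that, of "\<lambda>_. lborel :: real measure"] by simp
  thus ?thesis using False by (auto simp: pi_of_def intro!: borel_measurable_diff borel_measurable_sum)
qed

text \<open>Dirichlet aggregation: integrating out how the last two labels share their common mass
  merges them into one label with the sum of their parameters, at the price of a Beta factor. With
  no free coordinate left, the product measure is a unit point mass.\<close>

lemma nn_integral_Dirichlet:
  fixes \<alpha> :: "nat \<Rightarrow> real"
  assumes "\<And>a. a \<le> m \<Longrightarrow> 0 < \<alpha> a"
  shows "(\<integral>\<^sup>+ u. ennreal (if \<forall>a<Suc m. 0 < pi_of (Suc m) u a
        then \<Prod>a<Suc m. pi_of (Suc m) u a powr (\<alpha> a - 1) else 0) \<partial>PiM {..<m} (\<lambda>_. lborel))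
    = ennreal ((\<Prod>a<Suc m. Gamma (\<alpha> a)) / Gamma (\<Sum>a<Suc m. \<alpha> a))"
  using assms
proof (induction m arbitrary: \<alpha>)
  case 0
  have "Gamma (\<alpha> 0) > 0" using 0[of 0] by simp
  moreover have "emeasure (PiM {} (\<lambda>_. lborel :: real measure)) (space (PiM {} (\<lambda>_::nat. lborel :: real measure))) = 1"
    by (simp add: space_PiM PiM_empty)
  ultimately show ?case by (simp add: pi_of_def)
next
  case (Suc m)
  interpret product_sigma_finite "\<lambda>_::nat. lborel :: real measure" ..
  define \<beta> where "\<beta> = \<alpha>(m := \<alpha> m + \<alpha> (Suc m))"
  have pos: "\<alpha> m > 0" "\<alpha> (Suc m) > 0" using Suc.prems by auto
  let ?f = "\<lambda>u. ennreal (if \<forall>a<Suc (Suc m). 0 < pi_of (Suc (Suc m)) u a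
        then \<Prod>a<Suc (Suc m). pi_of (Suc (Suc m)) u a powr (\<alpha> a - 1) else 0)"
  let ?h = "\<lambda>u. ennreal (if \<forall>a<Suc m. 0 < pi_of (Suc m) u a
        then \<Prod>a<Suc m. pi_of (Suc m) u a powr (\<beta> a - 1) else 0)"
  have meas: "?f \<in> borel_measurable (PiM (insert m {..<m}) (\<lambda>_. lborel))"
  proof -
    note measurable_pi_of[of "Suc (Suc m)", simplified, measurable]
    have "?f \<in> borel_measurable (PiM {..<Suc m} (\<lambda>_. lborel))" by measurable
    thus ?thesis by (simp add: lessThan_Suc)
  qed
  have meas': "?h \<in> borel_measurable (PiM {..<m} (\<lambda>_. lborel))"
  proof -
    note measurable_pi_of[of "Suc m", simplified, measurable]
    show ?thesis by measurable
  qed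
  have "(\<integral>\<^sup>+ u. ?f u \<partial>PiM {..<Suc m} (\<lambda>_. lborel))
      = (\<integral>\<^sup>+ u. (\<integral>\<^sup>+ y. ?f (u(m := y)) \<partial>lborel) \<partial>PiM {..<m} (\<lambda>_. lborel))"
    unfolding lessThan_Suc[of m] using meas by (subst product_nn_integral_insert) auto
  also have "\<dots> = (\<integral>\<^sup>+ u. ennreal (Beta (\<alpha> m) (\<alpha> (Suc m))) * ?h u \<partial>PiM {..<m} (\<lambda>_. lborel))"
  proof (intro nn_integral_cong)
    fix u :: "nat \<Rightarrow> real"
    \<comment> \<open>The mass left by the first \<open>m\<close> coordinates: label
      \<open>m\<close> takes \<open>y\<close> of it, and the last label, being one minus the others,
      gets \<open>s - y\<close>.\<close>
    define s where "s = 1 - (\<Sum>b<m. u b)"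
    define c where "c = (if \<forall>a<m. 0 < u a then \<Prod>a<m. u a powr (\<alpha> a - 1) else 0)"
    have c0: "c \<ge> 0" by (auto simp: c_def intro!: prod_nonneg)
    have pi1: "pi_of (Suc (Suc m)) (u(m := y)) a = (if a < m then u a else if a = m then y else s - y)" for a y
      by (simp add: pi_of_def s_def)
    have pi2: "pi_of (Suc m) u a = (if a < m then u a else s)" for a
      by (simp add: pi_of_def s_def)
    have f: "?f (u(m := y)) = ennreal c * ennreal (if 0 < y \<and> 0 < s - y
        then y powr (\<alpha> m - 1) * (s - y) powr (\<alpha> (Suc m) - 1) else 0)" for y
      unfolding pi1 using c0 by (subst ennreal_mult'[symmetric]) (auto simp: c_def less_Suc_eq mult_ac)
    have h: "?h u = ennreal c * ennreal (if 0 < s then s powr (\<alpha> m + \<alpha> (Suc m) - 1) else 0)"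
      unfolding pi2 using c0 by (subst ennreal_mult'[symmetric]) (auto simp: c_def less_Suc_eq \<beta>_def mult_ac)
    have "(\<integral>\<^sup>+ y. ?f (u(m := y)) \<partial>lborel)
        = ennreal c * ennreal (if 0 < s then s powr (\<alpha> m + \<alpha> (Suc m) - 1) * Beta (\<alpha> m) (\<alpha> (Suc m)) else 0)"
      unfolding f nn_integral_Beta_scaled[OF pos, symmetric] by (rule nn_integral_cmult) measurable
    also have "\<dots> = ennreal (Beta (\<alpha> m) (\<alpha> (Suc m))) * ?h u"
    proof (cases "0 < s")
      case True
      have "ennreal (s powr (\<alpha> m + \<alpha> (Suc m) - 1) * Beta (\<alpha> m) (\<alpha> (Suc m)))
          = ennreal (s powr (\<alpha> m + \<alpha> (Suc m) - 1)) * ennreal (Beta (\<alpha> m) (\<alpha> (Suc m)))"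
        by (rule ennreal_mult') simp
      thus ?thesis using True unfolding h by (simp only: if_True mult_ac)
    qed (simp add: h)
    finally show "(\<integral>\<^sup>+ y. ?f (u(m := y)) \<partial>lborel) = ennreal (Beta (\<alpha> m) (\<alpha> (Suc m))) * ?h u" .
  qed
  also have "\<dots> = ennreal (Beta (\<alpha> m) (\<alpha> (Suc m))) *
      ennreal ((\<Prod>a<Suc m. Gamma (\<beta> a)) / Gamma (\<Sum>a<Suc m. \<beta> a))"
  proof -
    have "0 < \<beta> a" if "a \<le> m" for a
      using Suc.prems[of a] that pos by (cases "a = m") (auto simp: \<beta>_def)
    from Suc.IH[OF this] show ?thesis by (simp only: nn_integral_cmult[OF meas'])
  qed
  also have "\<dots> = ennreal (Beta (\<alpha> m) (\<alpha> (Suc m)) * ((\<Prod>a<Suc m. Gamma (\<beta> a)) / Gamma (\<Sum>a<Suc m. \<beta> a)))"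
    using pos by (intro ennreal_mult'[symmetric]) (simp add: Beta_def)
  also have "Beta (\<alpha> m) (\<alpha> (Suc m)) * ((\<Prod>a<Suc m. Gamma (\<beta> a)) / Gamma (\<Sum>a<Suc m. \<beta> a))
     = (\<Prod>a<Suc (Suc m). Gamma (\<alpha> a)) / Gamma (\<Sum>a<Suc (Suc m). \<alpha> a)"
  proof -
    have "Gamma (\<alpha> m + \<alpha> (Suc m)) > 0" using pos by (intro Gamma_real_pos) auto
    moreover have "x / g * (p * g / G) = p * x / G" if "g > 0" for x g p G :: real
      using that by simp
    moreover have "(\<Prod>a<Suc m. Gamma (\<beta> a)) = (\<Prod>a<m. Gamma (\<alpha> a)) * Gamma (\<alpha> m + \<alpha> (Suc m))"
      "(\<Sum>a<Suc m. \<beta> a) = (\<Sum>a<Suc (Suc m). \<alpha> a)"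
      by (auto simp: \<beta>_def intro!: prod.cong sum.cong)
    moreover have "(\<Prod>a<Suc (Suc m). Gamma (\<alpha> a)) = (\<Prod>a<m. Gamma (\<alpha> a)) * (Gamma (\<alpha> m) * Gamma (\<alpha> (Suc m)))"
      by simp
    ultimately show ?thesis unfolding Beta_def by metis
  qed
  finally show ?case .
qed

text \<open>Conjugacy: the powers shift each Dirichlet parameter from \<open>1/2\<close> to
  \<open>N a + 1/2\<close>. Where the density does not vanish, all weights are positive, so natural
  powers merge with \<open>powr\<close>.\<close>

lemma nn_integral_Dirichlet_half_moment:
  fixes N :: "nat \<Rightarrow> nat"
  assumes "1 \<le> k"
  shows "(\<integral>\<^sup>+ u. ennreal (dirichlet_half_density k u * (\<Prod>a<k. pi_of k u a ^ N a)) \<partial>PiM {..<k - 1} (\<lambda>_. lborel))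
    = ennreal (Gamma (real k / 2) * ((\<Prod>a<k. Gamma (real (N a) + 1/2)) /
        (Gamma (1/2) ^ k * Gamma (real (\<Sum>a<k. N a) + real k / 2))))"
proof -
  obtain m where k: "k = Suc m" using assms by (cases k) auto
  let ?C = "Gamma (real k / 2) / Gamma (1/2) ^ k"
  let ?h = "\<lambda>u. ennreal (if \<forall>a<Suc m. 0 < pi_of (Suc m) u a
        then \<Prod>a<Suc m. pi_of (Suc m) u a powr ((real (N a) + 1/2) - 1) else 0)"
  have C0: "?C \<ge> 0" using assms by (intro divide_nonneg_nonneg zero_le_power Gamma_real_nonneg) auto
  have [measurable]: "?h \<in> borel_measurable (PiM {..<m} (\<lambda>_. lborel))"
  proof -
    note measurable_pi_of[of "Suc m", simplified, measurable]
    show ?thesis by measurable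
  qed
  have "ennreal (dirichlet_half_density k u * (\<Prod>a<k. pi_of k u a ^ N a)) = ennreal ?C * ?h u" for u
  proof (cases "\<forall>a<k. 0 < pi_of k u a")
    case True
    have "(\<Prod>a<k. pi_of k u a powr (-1/2)) * (\<Prod>a<k. pi_of k u a ^ N a)
       = (\<Prod>a<k. pi_of k u a powr ((real (N a) + 1/2) - 1))"
      unfolding prod.distrib[symmetric]
    proof (intro prod.cong refl)
      fix a assume "a \<in> {..<k}"
      hence "pi_of k u a > 0" using True by auto
      hence "pi_of k u a powr (-1/2) * pi_of k u a ^ N a = pi_of k u a powr (-1/2 + real (N a))"
        by (simp only: powr_add powr_realpow)
      also have "-1/2 + real (N a) = (real (N a) + 1/2) - 1" by simp
      finally show "pi_of k u a powr (-1/2) * pi_of k u a ^ N a = pi_of k u a powr ((real (N a) + 1/2) - 1)" .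
    qed
    thus ?thesis using C0 unfolding dirichlet_half_density_def k[symmetric] if_P[OF True]
      by (subst ennreal_mult'[symmetric]) (simp_all only: mult.assoc)
  next
    case False
    thus ?thesis unfolding dirichlet_half_density_def k[symmetric] if_not_P[OF False] by simp
  qed
  hence "(\<integral>\<^sup>+ u. ennreal (dirichlet_half_density k u * (\<Prod>a<k. pi_of k u a ^ N a)) \<partial>PiM {..<k - 1} (\<lambda>_. lborel))
     = (\<integral>\<^sup>+ u. ennreal ?C * ?h u \<partial>PiM {..<m} (\<lambda>_. lborel))"
    by (simp only: k diff_Suc_1)
  also have "\<dots> = ennreal ?C * ennreal ((\<Prod>a<k. Gamma (real (N a) + 1/2)) / Gamma (\<Sum>a<k. real (N a) + 1/2))"
    unfolding k by (subst nn_integral_cmult, measurable) (subst nn_integral_Dirichlet, auto)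
  also have "(\<Sum>a<k. real (N a) + 1/2) = real (\<Sum>a<k. N a) + real k / 2"
    by (simp add: sum.distrib)
  also have "ennreal ?C * ennreal ((\<Prod>a<k. Gamma (real (N a) + 1/2)) / Gamma (real (\<Sum>a<k. N a) + real k / 2))
     = ennreal (?C * ((\<Prod>a<k. Gamma (real (N a) + 1/2)) / Gamma (real (\<Sum>a<k. N a) + real k / 2)))"
    by (rule ennreal_mult'[OF C0, symmetric])
  finally show ?thesis by (simp only: times_divide_eq_left times_divide_eq_right divide_divide_eq_left mult_ac)
qed

lemma finite_pair_idx [simp]: "finite (pair_idx k)"
  by (rule finite_subset[of _ "{..<k} \<times> {..<k}"]) (auto simp: pair_idx_def)

text \<open>Prior and likelihood both factor over \<open>pair_idx k\<close>, so the integral is a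
  product of one-dimensional Beta integrals.\<close>

lemma nn_integral_Beta_half_moment:
  fixes o1 o0 :: "nat \<times> nat \<Rightarrow> nat"
  shows "(\<integral>\<^sup>+ v. ennreal (beta_half_density k v * (\<Prod>p\<in>pair_idx k. v p ^ o1 p * (1 - v p) ^ o0 p))
      \<partial>PiM (pair_idx k) (\<lambda>_. lborel))
    = ennreal (\<Prod>p\<in>pair_idx k. Beta (real (o1 p) + 1/2) (real (o0 p) + 1/2) / pi)"
proof -
  interpret product_sigma_finite "\<lambda>_::nat \<times> nat. lborel :: real measure" ..
  let ?g = "\<lambda>p y. ennreal (if 0 < y \<and> 0 < 1 - y
      then y powr ((real (o1 p) + 1/2) - 1) * (1 - y) powr ((real (o0 p) + 1/2) - 1) else 0)"
  have eq: "ennreal (beta_half_density k v * (\<Prod>p\<in>pair_idx k. v p ^ o1 p * (1 - v p) ^ o0 p))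
      = (\<Prod>p\<in>pair_idx k. ennreal (1 / pi) * ?g p (v p))" for v
  proof -
    have *: "(if 0 < y \<and> y < 1 then y powr (-1/2) * (1 - y) powr (-1/2) / pi else 0) * (y ^ i * (1 - y) ^ j)
       = 1 / pi * (if 0 < y \<and> 0 < 1 - y
      then y powr ((real i + 1/2) - 1) * (1 - y) powr ((real j + 1/2) - 1) else 0)" for y i j
    proof (cases "0 < y \<and> y < 1")
      case True
      hence True': "0 < y \<and> 0 < 1 - y" by simp
      have "x powr (real i + 1/2 - 1) = x powr (-1/2) * x ^ i" if "0 < x" for x :: real and i
      proof -
        have "real i + 1/2 - 1 = -1/2 + real i" by simp
        thus ?thesis using that by (simp only: powr_add powr_realpow)
      qed
      thus ?thesis using True unfolding if_P[OF True] if_P[OF True'] by simp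
    qed auto
    show ?thesis
      unfolding beta_half_density_def prod.distrib[symmetric] *
    proof (subst prod_ennreal[symmetric])
      show "(\<Prod>p\<in>pair_idx k. ennreal (1 / pi * (if 0 < v p \<and> 0 < 1 - v p
          then v p powr (real (o1 p) + 1/2 - 1) * (1 - v p) powr (real (o0 p) + 1/2 - 1) else 0)))
        = (\<Prod>p\<in>pair_idx k. ennreal (1 / pi) * ?g p (v p))"
        by (intro prod.cong refl ennreal_mult') simp
    qed simp
  qed
  have "(\<integral>\<^sup>+ v. (\<Prod>p\<in>pair_idx k. ennreal (1 / pi) * ?g p (v p)) \<partial>PiM (pair_idx k) (\<lambda>_. lborel))
     = (\<Prod>p\<in>pair_idx k. \<integral>\<^sup>+ y. ennreal (1 / pi) * ?g p y \<partial>lborel)"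
    by (rule product_nn_integral_prod) (simp, measurable)
  also have "\<dots> = (\<Prod>p\<in>pair_idx k. ennreal (1 / pi) * ennreal (Beta (real (o1 p) + 1/2) (real (o0 p) + 1/2)))"
  proof (intro prod.cong refl)
    fix p
    have "(\<integral>\<^sup>+ y. ennreal (1 / pi) * ?g p y \<partial>lborel) = ennreal (1 / pi) * (\<integral>\<^sup>+ y. ?g p y \<partial>lborel)"
      by (rule nn_integral_cmult) measurable
    also have "(\<integral>\<^sup>+ y. ?g p y \<partial>lborel) = ennreal (Beta (real (o1 p) + 1/2) (real (o0 p) + 1/2))"
      by (subst nn_integral_Beta_scaled) simp_all
    finally show "(\<integral>\<^sup>+ y. ennreal (1 / pi) * ?g p y \<partial>lborel)
       = ennreal (1 / pi) * ennreal (Beta (real (o1 p) + 1/2) (real (o0 p) + 1/2))" .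
  qed
  also have "\<dots> = ennreal (\<Prod>p\<in>pair_idx k. Beta (real (o1 p) + 1/2) (real (o0 p) + 1/2) / pi)"
  proof (subst prod_ennreal[symmetric])
    have b: "0 \<le> Beta (real (o1 p) + 1/2) (real (o0 p) + 1/2)" for p
      unfolding Beta_def by (intro divide_nonneg_nonneg mult_nonneg_nonneg Gamma_real_nonneg) auto
    show "0 \<le> Beta (real (o1 p) + 1/2) (real (o0 p) + 1/2) / pi" for p
      using b[of p] by simp
    show "(\<Prod>p\<in>pair_idx k. ennreal (1 / pi) * ennreal (Beta (real (o1 p) + 1/2) (real (o0 p) + 1/2)))
      = (\<Prod>p\<in>pair_idx k. ennreal (Beta (real (o1 p) + 1/2) (real (o0 p) + 1/2) / pi))"
    proof (intro prod.cong refl)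
      fix p
      show "ennreal (1 / pi) * ennreal (Beta (real (o1 p) + 1/2) (real (o0 p) + 1/2))
         = ennreal (Beta (real (o1 p) + 1/2) (real (o0 p) + 1/2) / pi)"
        using ennreal_mult'[of "1/pi" "Beta (real (o1 p) + 1/2) (real (o0 p) + 1/2)"] by simp
    qed
  qed
  finally show ?thesis unfolding eq .
qed

section \<open>The Krichevsky--Trofimov mixture\<close>

definition node_pairs :: "nat \<Rightarrow> (nat \<times> nat) set" where
  "node_pairs n = {(i, j). i < j \<and> j < n}"

definition labellings :: "nat \<Rightarrow> nat \<Rightarrow> (nat \<Rightarrow> nat) set" where
  "labellings n k = {0..<n} \<rightarrow>\<^sub>E {0..<k}"

definition edge_lik ::
  "nat \<Rightarrow> (nat \<Rightarrow> nat \<Rightarrow> real) \<Rightarrow> (nat \<Rightarrow> nat) \<Rightarrow> (nat \<Rightarrow> nat \<Rightarrow> bool) \<Rightarrow> real" where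
  "edge_lik n P z x = (\<Prod>e\<in>node_pairs n.
     if x (fst e) (snd e) then P (z (fst e)) (z (snd e)) else 1 - P (z (fst e)) (z (snd e)))"

text \<open>The unordered pair of labels of an edge, written increasingly so that it indexes a free
  entry in \<open>pair_idx\<close>.\<close>

definition block :: "(nat \<Rightarrow> nat) \<Rightarrow> nat \<times> nat \<Rightarrow> nat \<times> nat" where
  "block z e = (min (z (fst e)) (z (snd e)), max (z (fst e)) (z (snd e)))"

definition block_count :: "nat \<Rightarrow> (nat \<Rightarrow> nat) \<Rightarrow> (nat \<Rightarrow> nat \<Rightarrow> bool) \<Rightarrow> nat \<times> nat \<Rightarrow> nat" where
  "block_count n z x p = card {e \<in> node_pairs n. x (fst e) (snd e) \<and> block z e = p}"

definition label_count :: "nat \<Rightarrow> (nat \<Rightarrow> nat) \<Rightarrow> nat \<Rightarrow> nat" where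
  "label_count n z a = card {i \<in> {..<n}. z i = a}"

text \<open>Coding a network by its edge set turns the sample space into the finite set
  \<open>Pow (node_pairs n)\<close>, over which sums can be taken.\<close>

definition network :: "(nat \<times> nat) set \<Rightarrow> nat \<Rightarrow> nat \<Rightarrow> bool" where
  "network A i j \<longleftrightarrow> (i, j) \<in> A"

lemma finite_node_pairs [simp]: "finite (node_pairs n)"
  by (rule finite_subset[of _ "{..<n} \<times> {..<n}"]) (auto simp: node_pairs_def)

text \<open>The missing diagonal provides the strictness that \<open>Beta_half_moment_lower\<close>
  requires.\<close>

lemma card_node_pairs_less: "1 \<le> n \<Longrightarrow> card (node_pairs n) < n\<^sup>2"
proof -
  assume n: "1 \<le> n"
  have "card (node_pairs n) < card ({..<n} \<times> {..<n})"
  proof (rule psubset_card_mono)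
    have "(0, 0) \<in> {..<n} \<times> {..<n}" "(0, 0) \<notin> node_pairs n" using n by (auto simp: node_pairs_def)
    moreover have "node_pairs n \<subseteq> {..<n} \<times> {..<n}" by (auto simp: node_pairs_def)
    ultimately show "node_pairs n \<subset> {..<n} \<times> {..<n}" by blast
  qed simp
  thus ?thesis by (simp add: power2_eq_square)
qed

lemma finite_labellings [simp]: "finite (labellings n k)"
  by (simp add: labellings_def finite_PiE)

lemma card_labellings: "card (labellings n k) = k ^ n"
  by (simp add: labellings_def card_PiE)

lemma labellings_less: "z \<in> labellings n k \<Longrightarrow> i < n \<Longrightarrow> z i < k"
  by (auto simp: labellings_def PiE_iff)

lemma sbm_complete_lik_eq: "sbm_complete_lik n \<pi> P z x = (\<Prod>i<n. \<pi> (z i)) * edge_lik n P z x"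
  unfolding sbm_complete_lik_def edge_lik_def node_pairs_def[symmetric] by (simp add: case_prod_unfold)

lemma sbm_prob_eq: "sbm_prob n k \<pi> P x = (\<Sum>z\<in>labellings n k. (\<Prod>i<n. \<pi> (z i)) * edge_lik n P z x)"
  unfolding sbm_prob_def labellings_def sbm_complete_lik_eq ..

lemma edge_lik_nonneg:
  assumes "z \<in> labellings n k" "\<And>a b. a < k \<Longrightarrow> b < k \<Longrightarrow> 0 \<le> P a b \<and> P a b \<le> 1"
  shows "0 \<le> edge_lik n P z x"
proof -
  have "0 \<le> P (z (fst e)) (z (snd e)) \<and> P (z (fst e)) (z (snd e)) \<le> 1" if "e \<in> node_pairs n" for e
    using that assms labellings_less[OF assms(1)] by (auto simp: node_pairs_def)
  thus ?thesis unfolding edge_lik_def by (intro prod_nonneg) auto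
qed

text \<open>By symmetry \<open>P\<close> is constant on the pairs of a block, so each block
  contributes a binomial likelihood, the form to which Beta conjugacy and the maximum likelihood
  bound apply.\<close>

lemma edge_lik_blocks:
  assumes "z \<in> labellings n k" "\<And>a b. a < k \<Longrightarrow> b < k \<Longrightarrow> P a b = P b a"
  shows "edge_lik n P z x = (\<Prod>p\<in>pair_idx k. P (fst p) (snd p) ^ block_count n z x p *
           (1 - P (fst p) (snd p)) ^ block_count n z (\<lambda>i j. \<not> x i j) p)"
proof -
  let ?h = "\<lambda>e. if x (fst e) (snd e) then P (z (fst e)) (z (snd e)) else 1 - P (z (fst e)) (z (snd e))"
  have sub: "block z ` node_pairs n \<subseteq> pair_idx k"
    using labellings_less[OF assms(1)] by (auto simp: node_pairs_def pair_idx_def block_def)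
  have "edge_lik n P z x = (\<Prod>p\<in>pair_idx k. \<Prod>e\<in>{e \<in> node_pairs n. block z e = p}. ?h e)"
    unfolding edge_lik_def by (rule prod.group[symmetric, OF _ _ sub]) auto
  also have "\<dots> = (\<Prod>p\<in>pair_idx k. P (fst p) (snd p) ^ block_count n z x p *
           (1 - P (fst p) (snd p)) ^ block_count n z (\<lambda>i j. \<not> x i j) p)"
  proof (intro prod.cong refl)
    fix p
    let ?A = "{e \<in> node_pairs n. block z e = p}"
    have "(\<Prod>e\<in>?A. ?h e) = (\<Prod>e\<in>?A. if x (fst e) (snd e) then P (fst p) (snd p) else 1 - P (fst p) (snd p))"
    proof (intro prod.cong refl)
      fix e assume e: "e \<in> ?A"
      hence "z (fst e) < k" "z (snd e) < k"
        using labellings_less[OF assms(1)] by (auto simp: node_pairs_def)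
      hence "P (z (fst e)) (z (snd e)) = P (fst p) (snd p)"
        using e assms(2) by (auto simp: block_def min_def max_def)
      thus "?h e = (if x (fst e) (snd e) then P (fst p) (snd p) else 1 - P (fst p) (snd p))" by simp
    qed
    also have "\<dots> = P (fst p) (snd p) ^ card (?A \<inter> {e. x (fst e) (snd e)}) *
        (1 - P (fst p) (snd p)) ^ card (?A \<inter> - {e. x (fst e) (snd e)})"
      by (subst prod.If_cases) auto
    also have "?A \<inter> {e. x (fst e) (snd e)} = {e \<in> node_pairs n. x (fst e) (snd e) \<and> block z e = p}" by auto
    also have "?A \<inter> - {e. x (fst e) (snd e)} = {e \<in> node_pairs n. \<not> x (fst e) (snd e) \<and> block z e = p}" by auto
    finally show "(\<Prod>e\<in>?A. ?h e) = P (fst p) (snd p) ^ block_count n z x p *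
           (1 - P (fst p) (snd p)) ^ block_count n z (\<lambda>i j. \<not> x i j) p"
      by (simp add: block_count_def)
  qed
  finally show ?thesis .
qed

lemma block_count_add:
  "block_count n z x p + block_count n z (\<lambda>i j. \<not> x i j) p = card {e \<in> node_pairs n. block z e = p}"
proof -
  have "{e \<in> node_pairs n. block z e = p} = {e \<in> node_pairs n. x (fst e) (snd e) \<and> block z e = p} \<union>
     {e \<in> node_pairs n. \<not> x (fst e) (snd e) \<and> block z e = p}" by auto
  thus ?thesis unfolding block_count_def by (simp only:) (subst card_Un_disjoint, auto)
qed

lemma block_count_less:
  "1 \<le> n \<Longrightarrow> block_count n z x p + block_count n z (\<lambda>i j. \<not> x i j) p < n\<^sup>2"
  unfolding block_count_add
  by (rule le_less_trans[OF card_mono card_node_pairs_less]) auto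

lemma prod_labels:
  fixes \<pi> :: "nat \<Rightarrow> real"
  assumes "z \<in> labellings n k"
  shows "(\<Prod>i<n. \<pi> (z i)) = (\<Prod>a<k. \<pi> a ^ label_count n z a)"
proof -
  have "(\<Prod>i<n. \<pi> (z i)) = (\<Prod>a<k. \<Prod>i\<in>{i \<in> {..<n}. z i = a}. \<pi> (z i))"
    using labellings_less[OF assms] by (intro prod.group[symmetric]) auto
  also have "\<dots> = (\<Prod>a<k. \<pi> a ^ label_count n z a)"
    by (intro prod.cong refl) (simp add: label_count_def)
  finally show ?thesis .
qed

lemma sum_label_count:
  assumes "z \<in> labellings n k"
  shows "(\<Sum>a<k. label_count n z a) = n"
proof -
  have "n = (\<Sum>i<n. 1)" by simp
  also have "\<dots> = (\<Sum>a<k. \<Sum>i\<in>{i \<in> {..<n}. z i = a}. 1)"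
    using labellings_less[OF assms] by (intro sum.group[symmetric]) auto
  finally show ?thesis by (simp add: label_count_def)
qed

text \<open>The expansion of the product of all \<open>p + (1 - p)\<close>. As an algebraic identity
  it also holds for parameters outside the unit interval, hence at every point \<open>v\<close>
  under an integral.\<close>

lemma sum_edge_lik_networks: "(\<Sum>A\<in>Pow (node_pairs n). edge_lik n P z (network A)) = 1"
proof -
  let ?p = "\<lambda>e. P (z (fst e)) (z (snd e))"
  have "1 = (\<Prod>e\<in>node_pairs n. ?p e + (1 - ?p e))" by simp
  also have "\<dots> = (\<Sum>A\<in>Pow (node_pairs n). (\<Prod>e\<in>A. ?p e) * (\<Prod>e\<in>node_pairs n - A. 1 - ?p e))"
    by (rule prod_add) simp
  also have "\<dots> = (\<Sum>A\<in>Pow (node_pairs n). edge_lik n P z (network A))"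
  proof (intro sum.cong refl)
    fix A assume "A \<in> Pow (node_pairs n)"
    hence "node_pairs n \<inter> {e. e \<in> A} = A" "node_pairs n \<inter> - {e. e \<in> A} = node_pairs n - A" by auto
    thus "(\<Prod>e\<in>A. ?p e) * (\<Prod>e\<in>node_pairs n - A. 1 - ?p e) = edge_lik n P z (network A)"
      unfolding edge_lik_def network_def by (simp add: prod.If_cases)
  qed
  finally show ?thesis by simp
qed

lemma sum_prod_labels:
  "(\<Sum>z\<in>labellings n k. \<Prod>i<n. (\<pi> (z i) :: real)) = (\<Sum>a<k. \<pi> a) ^ n"
  using prod_sum_PiE[of "{0..<n}" "\<lambda>_. {0..<k}" "\<lambda>_ a. \<pi> a"]
  by (simp add: labellings_def atLeast0LessThan)

lemma card_pair_idx: "2 * card (pair_idx k) = k * (k + 1)"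
proof (induction k)
  case 0
  show ?case by (simp add: pair_idx_def)
next
  case (Suc k)
  have "pair_idx (Suc k) = pair_idx k \<union> (\<lambda>a. (a, k)) ` {..k}"
    by (auto simp: pair_idx_def less_Suc_eq)
  moreover have "card ((\<lambda>a. (a, k)) ` {..k}) = Suc k"
    by (subst card_image) (auto simp: inj_on_def)
  moreover have "pair_idx k \<inter> (\<lambda>a. (a, k)) ` {..k} = {}" by (auto simp: pair_idx_def)
  ultimately show ?case using Suc by (simp add: card_Un_disjoint)
qed

lemma sum_pi_of: "1 \<le> k \<Longrightarrow> (\<Sum>a<k. pi_of k u a) = 1"
  by (cases k) (simp_all add: pi_of_def)

lemma P_of_pair: "p \<in> pair_idx k \<Longrightarrow> P_of v (fst p) (snd p) = v p"
  by (auto simp: pair_idx_def P_of_def min_def max_def)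

lemma P_of_sym: "P_of v a b = P_of v b a"
  by (simp add: P_of_def min.commute max.commute)

lemma edge_lik_P_of:
  assumes "z \<in> labellings n k"
  shows "edge_lik n (P_of v) z x = (\<Prod>p\<in>pair_idx k. v p ^ block_count n z x p *
           (1 - v p) ^ block_count n z (\<lambda>i j. \<not> x i j) p)"
  by (subst edge_lik_blocks[OF assms]) (auto intro!: prod.cong simp: P_of_sym P_of_pair)

section \<open>The mixture as a probability distribution on networks\<close>

text \<open>The prior predictive law of the labels; \<open>beta_marginal\<close> is that of the
  network given the labels. Values in \<open>ennreal\<close> allow sums and integrals to be
  exchanged without integrability conditions.\<close>

definition dirichlet_marginal :: "nat \<Rightarrow> nat \<Rightarrow> (nat \<Rightarrow> nat) \<Rightarrow> ennreal" where
  "dirichlet_marginal n k z = (\<integral>\<^sup>+ u. ennreal (dirichlet_half_density k u * (\<Prod>i<n. pi_of k u (z i)))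
     \<partial>PiM {..<k - 1} (\<lambda>_. lborel))"

definition beta_marginal :: "nat \<Rightarrow> nat \<Rightarrow> (nat \<Rightarrow> nat) \<Rightarrow> (nat \<Rightarrow> nat \<Rightarrow> bool) \<Rightarrow> ennreal" where
  "beta_marginal n k z x = (\<integral>\<^sup>+ v. ennreal (beta_half_density k v * edge_lik n (P_of v) z x)
     \<partial>PiM (pair_idx k) (\<lambda>_. lborel))"

lemma dirichlet_half_density_nonneg: "1 \<le> k \<Longrightarrow> 0 \<le> dirichlet_half_density k u"
  unfolding dirichlet_half_density_def
  by (auto intro!: mult_nonneg_nonneg divide_nonneg_nonneg prod_nonneg Gamma_real_nonneg zero_le_power)

lemma beta_half_density_nonneg: "0 \<le> beta_half_density k v"
  unfolding beta_half_density_def by (intro prod_nonneg) auto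

text \<open>Outside the simplex a weight may be negative, but there the density vanishes.\<close>

lemma dirichlet_term_nonneg:
  assumes "1 \<le> k" "z \<in> labellings n k"
  shows "0 \<le> dirichlet_half_density k u * (\<Prod>i<n. pi_of k u (z i))"
proof (cases "\<forall>a<k. 0 < pi_of k u a")
  case True
  hence "0 \<le> (\<Prod>i<n. pi_of k u (z i))"
    using labellings_less[OF assms(2)] by (intro prod_nonneg) (auto intro: less_imp_le)
  thus ?thesis using dirichlet_half_density_nonneg[OF assms(1)] by (intro mult_nonneg_nonneg) auto
next
  case False
  hence "dirichlet_half_density k u = 0" unfolding dirichlet_half_density_def by (rule if_not_P)
  thus ?thesis by simp
qed

lemma beta_half_density_eq_0:
  assumes "p \<in> pair_idx k" "\<not> (0 < v p \<and> v p < 1)"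
  shows "beta_half_density k v = 0"
  unfolding beta_half_density_def by (rule prod_zero) (use assms in auto)

lemma beta_term_nonneg:
  assumes "z \<in> labellings n k"
  shows "0 \<le> beta_half_density k v * edge_lik n (P_of v) z x"
proof (cases "\<forall>p\<in>pair_idx k. 0 < v p \<and> v p < 1")
  case True
  thus ?thesis unfolding edge_lik_P_of[OF assms]
    by (intro mult_nonneg_nonneg beta_half_density_nonneg prod_nonneg) (auto intro: less_imp_le)
next
  case False
  thus ?thesis using beta_half_density_eq_0[of _ k v] by auto
qed

lemma measurable_dirichlet_half_density [measurable]:
  assumes "1 \<le> k"
  shows "dirichlet_half_density k \<in> borel_measurable (PiM {..<k - 1} (\<lambda>_. lborel))"
proof -
  note measurable_pi_of[OF assms, measurable]
  show ?thesis unfolding dirichlet_half_density_def by measurable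
qed

lemma measurable_dirichlet_term:
  assumes "1 \<le> k"
  shows "(\<lambda>u. dirichlet_half_density k u * (\<Prod>i<n. pi_of k u (z i))) \<in> borel_measurable (PiM {..<k - 1} (\<lambda>_. lborel))"
proof -
  note measurable_pi_of[OF assms, measurable] measurable_dirichlet_half_density[OF assms, measurable]
  show ?thesis by measurable
qed

lemma measurable_beta_half_density [measurable]:
  "beta_half_density k \<in> borel_measurable (PiM (pair_idx k) (\<lambda>_. lborel))"
proof -
  have "(\<lambda>v. v p) \<in> borel_measurable (PiM (pair_idx k) (\<lambda>_. lborel :: real measure))" if "p \<in> pair_idx k" for p
    using measurable_component_singleton[OF that, of "\<lambda>_. lborel :: real measure"] by simp
  note [measurable] = this
  show ?thesis unfolding beta_half_density_def by measurable
qed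

lemma measurable_beta_term:
  assumes "z \<in> labellings n k"
  shows "(\<lambda>v. beta_half_density k v * edge_lik n (P_of v) z x) \<in> borel_measurable (PiM (pair_idx k) (\<lambda>_. lborel))"
proof -
  have "(\<lambda>v. v p) \<in> borel_measurable (PiM (pair_idx k) (\<lambda>_. lborel :: real measure))" if "p \<in> pair_idx k" for p
    using measurable_component_singleton[OF that, of "\<lambda>_. lborel :: real measure"] by simp
  note [measurable] = this
  show ?thesis unfolding edge_lik_P_of[OF assms] by measurable
qed

definition KT_sum :: "nat \<Rightarrow> nat \<Rightarrow> (nat \<Rightarrow> nat \<Rightarrow> bool) \<Rightarrow> ennreal" where
  "KT_sum n k x = (\<Sum>z\<in>labellings n k. dirichlet_marginal n k z * beta_marginal n k z x)"

text \<open>The priors are independent, and for a fixed labelling the likelihood separates into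
  label weights and edge terms, so each labelling contributes a product of two integrals.\<close>

lemma KT_eq_KT_sum:
  assumes "1 \<le> k"
  shows "KT n k x = enn2real (KT_sum n k x)"
proof -
  let ?d = "\<lambda>u z. dirichlet_half_density k u * (\<Prod>i<n. pi_of k u (z i))"
  let ?b = "\<lambda>v z. beta_half_density k v * edge_lik n (P_of v) z x"
  have eq: "ennreal (dirichlet_half_density k u * beta_half_density k v * sbm_prob n k (pi_of k u) (P_of v) x)
      = (\<Sum>z\<in>labellings n k. ennreal (?d u z) * ennreal (?b v z))" for u v
  proof -
    have e1: "dirichlet_half_density k u * beta_half_density k v * sbm_prob n k (pi_of k u) (P_of v) x
       = (\<Sum>z\<in>labellings n k. ?d u z * ?b v z)"
      unfolding sbm_prob_eq sum_distrib_left by (intro sum.cong refl) (simp only: mult_ac)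
    have "ennreal (dirichlet_half_density k u * beta_half_density k v * sbm_prob n k (pi_of k u) (P_of v) x)
       = (\<Sum>z\<in>labellings n k. ennreal (?d u z * ?b v z))"
      unfolding e1
    proof (rule sum_ennreal[symmetric])
      fix z assume z: "z \<in> labellings n k"
      show "0 \<le> ?d u z * ?b v z"
        by (rule mult_nonneg_nonneg[OF dirichlet_term_nonneg[OF assms z] beta_term_nonneg[OF z]])
    qed
    also have "\<dots> = (\<Sum>z\<in>labellings n k. ennreal (?d u z) * ennreal (?b v z))"
    proof (rule sum.cong[OF refl])
      fix z assume z: "z \<in> labellings n k"
      show "ennreal (?d u z * ?b v z) = ennreal (?d u z) * ennreal (?b v z)"
        by (rule ennreal_mult'[OF dirichlet_term_nonneg[OF assms z]])
    qed
    finally show ?thesis .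
  qed
  have inner: "(\<integral>\<^sup>+ v. (\<Sum>z\<in>labellings n k. ennreal (?d u z) * ennreal (?b v z)) \<partial>PiM (pair_idx k) (\<lambda>_. lborel))
     = (\<Sum>z\<in>labellings n k. ennreal (?d u z) * beta_marginal n k z x)" for u
  proof (subst nn_integral_sum)
    fix z assume z: "z \<in> labellings n k"
    note measurable_beta_term[OF z, measurable]
    show "(\<lambda>v. ennreal (?d u z) * ennreal (?b v z)) \<in> borel_measurable (PiM (pair_idx k) (\<lambda>_. lborel))"
      by measurable
  next
    show "(\<Sum>z\<in>labellings n k. \<integral>\<^sup>+ v. ennreal (?d u z) * ennreal (?b v z) \<partial>PiM (pair_idx k) (\<lambda>_. lborel))
      = (\<Sum>z\<in>labellings n k. ennreal (?d u z) * beta_marginal n k z x)"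
      unfolding beta_marginal_def
      by (intro sum.cong refl nn_integral_cmult measurable_compose[OF measurable_beta_term measurable_ennreal])
  qed
  have "(\<integral>\<^sup>+ u. (\<Sum>z\<in>labellings n k. ennreal (?d u z) * beta_marginal n k z x) \<partial>PiM {..<k - 1} (\<lambda>_. lborel))
     = KT_sum n k x"
  proof (subst nn_integral_sum)
    fix z
    note measurable_dirichlet_term[OF assms, where n = n and z = z, measurable]
    show "(\<lambda>u. ennreal (?d u z) * beta_marginal n k z x) \<in> borel_measurable (PiM {..<k - 1} (\<lambda>_. lborel))"
      by measurable
  next
    show "(\<Sum>z\<in>labellings n k. \<integral>\<^sup>+ u. ennreal (?d u z) * beta_marginal n k z x \<partial>PiM {..<k - 1} (\<lambda>_. lborel))
      = KT_sum n k x"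
      unfolding KT_sum_def dirichlet_marginal_def
      by (intro sum.cong refl nn_integral_multc measurable_compose[OF measurable_dirichlet_term[OF assms] measurable_ennreal])
  qed
  thus ?thesis unfolding KT_def eq inner by simp
qed

lemma nn_integral_dirichlet_half_density:
  assumes "1 \<le> k"
  shows "(\<integral>\<^sup>+ u. ennreal (dirichlet_half_density k u) \<partial>PiM {..<k - 1} (\<lambda>_. lborel)) = 1"
proof -
  have "Gamma (real k / 2) > 0" using assms by (intro Gamma_real_pos) auto
  thus ?thesis using nn_integral_Dirichlet_half_moment[OF assms, of "\<lambda>_. 0"]
    by (simp add: Gamma_one_half_real)
qed

lemma nn_integral_beta_half_density:
  "(\<integral>\<^sup>+ v. ennreal (beta_half_density k v) \<partial>PiM (pair_idx k) (\<lambda>_. lborel)) = 1"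
  using nn_integral_Beta_half_moment[of k "\<lambda>_. 0" "\<lambda>_. 0"] by (simp add: Beta_def Gamma_one_half_real)

lemma sum_dirichlet_marginal:
  assumes "1 \<le> k"
  shows "(\<Sum>z\<in>labellings n k. dirichlet_marginal n k z) = 1"
proof -
  let ?d = "\<lambda>u z. dirichlet_half_density k u * (\<Prod>i<n. pi_of k u (z i))"
  have "(\<Sum>z\<in>labellings n k. dirichlet_marginal n k z)
      = (\<integral>\<^sup>+ u. (\<Sum>z\<in>labellings n k. ennreal (?d u z)) \<partial>PiM {..<k - 1} (\<lambda>_. lborel))"
    unfolding dirichlet_marginal_def
    by (intro nn_integral_sum[symmetric] measurable_compose[OF measurable_dirichlet_term[OF assms] measurable_ennreal])
  also have "\<dots> = (\<integral>\<^sup>+ u. ennreal (dirichlet_half_density k u) \<partial>PiM {..<k - 1} (\<lambda>_. lborel))"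
  proof (intro nn_integral_cong)
    fix u
    have "(\<Sum>z\<in>labellings n k. ennreal (?d u z)) = ennreal (\<Sum>z\<in>labellings n k. ?d u z)"
      by (intro sum_ennreal dirichlet_term_nonneg[OF assms])
    also have "(\<Sum>z\<in>labellings n k. ?d u z) = dirichlet_half_density k u"
      by (simp add: sum_prod_labels sum_pi_of[OF assms] flip: sum_distrib_left)
    finally show "(\<Sum>z\<in>labellings n k. ennreal (?d u z)) = ennreal (dirichlet_half_density k u)" .
  qed
  finally show ?thesis using nn_integral_dirichlet_half_density[OF assms] by simp
qed

lemma dirichlet_marginal_le_1:
  assumes "1 \<le> k" "z \<in> labellings n k"
  shows "dirichlet_marginal n k z \<le> 1"
  using member_le_sum[of z "labellings n k" "dirichlet_marginal n k"] assms
  by (simp add: sum_dirichlet_marginal)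

lemma sum_beta_marginal:
  assumes "z \<in> labellings n k"
  shows "(\<Sum>A\<in>Pow (node_pairs n). beta_marginal n k z (network A)) = 1"
proof -
  let ?b = "\<lambda>v A. beta_half_density k v * edge_lik n (P_of v) z (network A)"
  have "(\<Sum>A\<in>Pow (node_pairs n). beta_marginal n k z (network A))
      = (\<integral>\<^sup>+ v. (\<Sum>A\<in>Pow (node_pairs n). ennreal (?b v A)) \<partial>PiM (pair_idx k) (\<lambda>_. lborel))"
    unfolding beta_marginal_def
    by (intro nn_integral_sum[symmetric] measurable_compose[OF measurable_beta_term[OF assms] measurable_ennreal])
  also have "\<dots> = (\<integral>\<^sup>+ v. ennreal (beta_half_density k v) \<partial>PiM (pair_idx k) (\<lambda>_. lborel))"
  proof (intro nn_integral_cong)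
    fix v
    have "(\<Sum>A\<in>Pow (node_pairs n). ennreal (?b v A)) = ennreal (\<Sum>A\<in>Pow (node_pairs n). ?b v A)"
      by (intro sum_ennreal beta_term_nonneg[OF assms])
    also have "(\<Sum>A\<in>Pow (node_pairs n). ?b v A) = beta_half_density k v"
      by (simp add: sum_edge_lik_networks flip: sum_distrib_left)
    finally show "(\<Sum>A\<in>Pow (node_pairs n). ennreal (?b v A)) = ennreal (beta_half_density k v)" .
  qed
  finally show ?thesis using nn_integral_beta_half_density by simp
qed

text \<open>An average over a probability density is at most the supremum, and the density vanishes
  outside the unit cube, so a bound on the cube suffices.\<close>

lemma beta_marginal_le:
  assumes "\<And>v. (\<And>p. p \<in> pair_idx k \<Longrightarrow> 0 \<le> v p \<and> v p \<le> 1) \<Longrightarrow> edge_lik n (P_of v) z x \<le> C" "0 \<le> C"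
  shows "beta_marginal n k z x \<le> ennreal C"
proof -
  have "beta_marginal n k z x \<le> (\<integral>\<^sup>+ v. ennreal C * ennreal (beta_half_density k v) \<partial>PiM (pair_idx k) (\<lambda>_. lborel))"
    unfolding beta_marginal_def
  proof (intro nn_integral_mono)
    fix v
    have "beta_half_density k v * edge_lik n (P_of v) z x \<le> C * beta_half_density k v"
    proof (cases "\<forall>p\<in>pair_idx k. 0 < v p \<and> v p < 1")
      case True
      hence "edge_lik n (P_of v) z x \<le> C" by (intro assms) (auto intro: less_imp_le)
      thus ?thesis using beta_half_density_nonneg[of k v]
        by (metis mult.commute mult_left_mono)
    next
      case False
      thus ?thesis using beta_half_density_eq_0[of _ k v] by auto
    qed
    thus "ennreal (beta_half_density k v * edge_lik n (P_of v) z x) \<le> ennreal C * ennreal (beta_half_density k v)"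
      using assms(2) by (subst ennreal_mult'[symmetric]) (auto intro: ennreal_leI)
  qed
  also have "\<dots> = ennreal C"
    by (subst nn_integral_cmult) (auto simp: nn_integral_beta_half_density)
  finally show ?thesis .
qed

lemma sum_KT_sum:
  assumes "1 \<le> k"
  shows "(\<Sum>A\<in>Pow (node_pairs n). KT_sum n k (network A)) = 1"
  unfolding KT_sum_def
  by (subst sum.swap) (simp add: sum_beta_marginal sum_dirichlet_marginal[OF assms] flip: sum_distrib_left)

text \<open>Total mass one makes every value finite, so \<open>enn2real\<close> in \<open>KT\<close>
  does not send an infinite integral to zero.\<close>

lemma KT_network:
  assumes "1 \<le> k" "A \<in> Pow (node_pairs n)"
  shows "ennreal (KT n k (network A)) = KT_sum n k (network A)"
proof -
  have "KT_sum n k (network A) \<le> 1"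
    using member_le_sum[of A "Pow (node_pairs n)" "\<lambda>A. KT_sum n k (network A)"] assms
    by (simp add: sum_KT_sum)
  hence "KT_sum n k (network A) < \<top>" by (rule order.strict_trans1) simp
  thus ?thesis using assms by (simp add: KT_eq_KT_sum)
qed

lemma sum_KT_networks:
  assumes "1 \<le> k"
  shows "(\<Sum>A\<in>Pow (node_pairs n). KT n k (network A)) = 1"
proof -
  have "ennreal (\<Sum>A\<in>Pow (node_pairs n). KT n k (network A)) = (\<Sum>A\<in>Pow (node_pairs n). ennreal (KT n k (network A)))"
    by (intro sum_ennreal[symmetric]) (simp add: KT_def)
  also have "\<dots> = 1" using sum_KT_sum[OF assms] by (simp add: KT_network[OF assms])
  finally show ?thesis by (simp add: ennreal_eq_1)
qed

section \<open>Bounds on the mixture\<close>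

lemma dirichlet_marginal_lower:
  assumes "1 \<le> k" "1 \<le> n" "z \<in> labellings n k" "\<And>a. a < k \<Longrightarrow> 0 \<le> \<pi> a" "(\<Sum>a<k. \<pi> a) = 1"
  shows "ennreal (Gamma (real k / 2) / (exp 1 * sqrt (real n + real (k - 1)) ^ (k - 1)) * (\<Prod>i<n. \<pi> (z i)))
    \<le> dirichlet_marginal n k z"
proof -
  have "(\<Prod>a<k. \<pi> a ^ label_count n z a) / (exp 1 * sqrt (real n + real (k - 1)) ^ (k - 1))
    \<le> (\<Prod>a<k. Gamma (real (label_count n z a) + 1/2)) / (Gamma (1/2) ^ k * Gamma (real n + real k / 2))"
    using assms by (intro Dirichlet_half_moment_lower sum_label_count)
  hence "Gamma (real k / 2) * ((\<Prod>a<k. \<pi> a ^ label_count n z a) / (exp 1 * sqrt (real n + real (k - 1)) ^ (k - 1)))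
    \<le> Gamma (real k / 2) * ((\<Prod>a<k. Gamma (real (label_count n z a) + 1/2)) / (Gamma (1/2) ^ k * Gamma (real n + real k / 2)))"
    using assms(1) by (intro mult_left_mono Gamma_real_nonneg) auto
  thus ?thesis
    unfolding dirichlet_marginal_def prod_labels[OF assms(3)] nn_integral_Dirichlet_half_moment[OF assms(1)]
      sum_label_count[OF assms(3)]
    by (intro ennreal_leI) (simp add: mult_ac)
qed

lemma beta_marginal_lower:
  assumes "1 \<le> n" "z \<in> labellings n k" "\<And>a b. a < k \<Longrightarrow> b < k \<Longrightarrow> P a b = P b a"
    "\<And>a b. a < k \<Longrightarrow> b < k \<Longrightarrow> 0 \<le> P a b \<and> P a b \<le> 1"
  shows "ennreal (edge_lik n P z x * (1 / (exp 1 * real n)) ^ card (pair_idx k)) \<le> beta_marginal n k z x"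
proof -
  have E: "edge_lik n P z x = (\<Prod>p\<in>pair_idx k. P (fst p) (snd p) ^ block_count n z x p *
      (1 - P (fst p) (snd p)) ^ block_count n z (\<lambda>i j. \<not> x i j) p)"
    using assms(2,3) by (rule edge_lik_blocks)
  have "edge_lik n P z x * (1 / (exp 1 * real n)) ^ card (pair_idx k)
     = (\<Prod>p\<in>pair_idx k. P (fst p) (snd p) ^ block_count n z x p *
           (1 - P (fst p) (snd p)) ^ block_count n z (\<lambda>i j. \<not> x i j) p / (exp 1 * real n))"
    unfolding E by (simp add: prod_dividef power_divide)
  also have "\<dots> \<le> (\<Prod>p\<in>pair_idx k. Beta (real (block_count n z x p) + 1/2)
       (real (block_count n z (\<lambda>i j. \<not> x i j) p) + 1/2) / pi)"
  proof (intro prod_mono conjI)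
    fix p assume "p \<in> pair_idx k"
    hence P: "0 \<le> P (fst p) (snd p)" "P (fst p) (snd p) \<le> 1"
      using assms(4) by (auto simp: pair_idx_def)
    thus "0 \<le> P (fst p) (snd p) ^ block_count n z x p *
           (1 - P (fst p) (snd p)) ^ block_count n z (\<lambda>i j. \<not> x i j) p / (exp 1 * real n)"
      by (intro divide_nonneg_nonneg mult_nonneg_nonneg zero_le_power) auto
    show "P (fst p) (snd p) ^ block_count n z x p *
           (1 - P (fst p) (snd p)) ^ block_count n z (\<lambda>i j. \<not> x i j) p / (exp 1 * real n)
      \<le> Beta (real (block_count n z x p) + 1/2) (real (block_count n z (\<lambda>i j. \<not> x i j) p) + 1/2) / pi"
      using P assms(1) by (intro Beta_half_moment_lower block_count_less)
  qed
  finally show ?thesis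
    unfolding beta_marginal_def edge_lik_P_of[OF assms(2)] nn_integral_Beta_half_moment
    by (rule ennreal_leI)
qed

lemma KT_lower_explicit:
  assumes "1 \<le> k" "1 \<le> n" "A \<in> Pow (node_pairs n)"
    "\<And>a. a < k \<Longrightarrow> 0 \<le> \<pi> a" "(\<Sum>a<k. \<pi> a) = 1"
    "\<And>a b. a < k \<Longrightarrow> b < k \<Longrightarrow> P a b = P b a"
    "\<And>a b. a < k \<Longrightarrow> b < k \<Longrightarrow> 0 \<le> P a b \<and> P a b \<le> 1"
  shows "Gamma (real k / 2) / (exp 1 * sqrt (real n + real (k - 1)) ^ (k - 1)) *
      (1 / (exp 1 * real n)) ^ card (pair_idx k) * sbm_prob n k \<pi> P (network A) \<le> KT n k (network A)"
proof -
  let ?c = "Gamma (real k / 2) / (exp 1 * sqrt (real n + real (k - 1)) ^ (k - 1))"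
  let ?d = "(1 / (exp 1 * real n)) ^ card (pair_idx k)"
  let ?x = "network A"
  have c0: "?c \<ge> 0" using assms(1) by (intro divide_nonneg_nonneg mult_nonneg_nonneg zero_le_power Gamma_real_nonneg) auto
  have p0: "0 \<le> (\<Prod>i<n. \<pi> (z i))" if "z \<in> labellings n k" for z
    using assms(4) labellings_less[OF that] by (intro prod_nonneg) auto
  have e0: "0 \<le> edge_lik n P z ?x" if "z \<in> labellings n k" for z
    using that assms(7) by (rule edge_lik_nonneg)
  have e1: "?c * ?d * sbm_prob n k \<pi> P ?x
      = (\<Sum>z\<in>labellings n k. (?c * (\<Prod>i<n. \<pi> (z i))) * (edge_lik n P z ?x * ?d))"
    unfolding sbm_prob_eq sum_distrib_left by (intro sum.cong refl) (simp only: mult_ac)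
  have "ennreal (?c * ?d * sbm_prob n k \<pi> P ?x)
      = (\<Sum>z\<in>labellings n k. ennreal (?c * (\<Prod>i<n. \<pi> (z i))) * ennreal (edge_lik n P z ?x * ?d))"
    unfolding e1
  proof (subst sum_ennreal[symmetric])
    fix z assume z: "z \<in> labellings n k"
    show "0 \<le> (?c * (\<Prod>i<n. \<pi> (z i))) * (edge_lik n P z ?x * ?d)"
      by (intro mult_nonneg_nonneg c0 p0[OF z] e0[OF z]) simp
  next
    show "(\<Sum>z\<in>labellings n k. ennreal ((?c * (\<Prod>i<n. \<pi> (z i))) * (edge_lik n P z ?x * ?d)))
      = (\<Sum>z\<in>labellings n k. ennreal (?c * (\<Prod>i<n. \<pi> (z i))) * ennreal (edge_lik n P z ?x * ?d))"
    proof (rule sum.cong[OF refl])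
      fix z assume z: "z \<in> labellings n k"
      show "ennreal ((?c * (\<Prod>i<n. \<pi> (z i))) * (edge_lik n P z ?x * ?d))
        = ennreal (?c * (\<Prod>i<n. \<pi> (z i))) * ennreal (edge_lik n P z ?x * ?d)"
        by (rule ennreal_mult'[OF mult_nonneg_nonneg[OF c0 p0[OF z]]])
    qed
  qed
  also have "\<dots> \<le> KT_sum n k ?x"
    unfolding KT_sum_def
  proof (rule sum_mono)
    fix z assume z: "z \<in> labellings n k"
    have "ennreal (?c * (\<Prod>i<n. \<pi> (z i))) \<le> dirichlet_marginal n k z"
      using assms(1,2) z assms(4,5) by (rule dirichlet_marginal_lower)
    moreover have "ennreal (edge_lik n P z ?x * ?d) \<le> beta_marginal n k z ?x"
      using assms(2) z assms(6,7) by (rule beta_marginal_lower)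
    ultimately show "ennreal (?c * (\<Prod>i<n. \<pi> (z i))) * ennreal (edge_lik n P z ?x * ?d)
        \<le> dirichlet_marginal n k z * beta_marginal n k z ?x"
      by (rule mult_mono) simp_all
  qed
  also have "\<dots> = ennreal (KT n k ?x)" using KT_network assms by simp
  finally show ?thesis by (simp add: KT_def)
qed

text \<open>The \<open>k - 1\<close> free weights cost an exponent \<open>1/2\<close> each and the
  \<open>k * (k + 1) / 2\<close> block entries cost \<open>1\<close> each. The constant is uniform
  in \<open>\<pi>\<close> and \<open>P\<close>, so the edge probabilities may vary with
  \<open>n\<close>.\<close>

lemma KT_lower:
  assumes "1 \<le> k"
  obtains C where "C > 0" "\<And>n A \<pi> P. \<lbrakk>1 \<le> n; A \<in> Pow (node_pairs n); \<And>a. a < k \<Longrightarrow> 0 \<le> \<pi> a; (\<Sum>a<k. \<pi> a) = 1;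
    \<And>a b. a < k \<Longrightarrow> b < k \<Longrightarrow> P a b = P b a; \<And>a b. a < k \<Longrightarrow> b < k \<Longrightarrow> 0 \<le> P a b \<and> P a b \<le> 1\<rbrakk>
    \<Longrightarrow> C * real n powr (- ((real k * (real k + 2) - 1) / 2)) * sbm_prob n k \<pi> P (network A) \<le> KT n k (network A)"
proof
  define K where "K = card (pair_idx k)"
  define C where "C = Gamma (real k / 2) / (exp 1 * sqrt (real k) ^ (k - 1)) * (1 / exp 1) ^ K"
  have G: "Gamma (real k / 2) > 0" using assms by (intro Gamma_real_pos) auto
  show C0: "C > 0" unfolding C_def using assms G by (intro mult_pos_pos divide_pos_pos zero_less_power) auto
  have K: "real K = real k * (real k + 1) / 2"
    using arg_cong[OF card_pair_idx[of k], of real] by (simp add: K_def algebra_simps)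
  fix n A and \<pi> :: "nat \<Rightarrow> real" and P :: "nat \<Rightarrow> nat \<Rightarrow> real"
  assume a: "1 \<le> n" "A \<in> Pow (node_pairs n)" "\<And>a. a < k \<Longrightarrow> 0 \<le> \<pi> a" "(\<Sum>a<k. \<pi> a) = 1"
    "\<And>a b. a < k \<Longrightarrow> b < k \<Longrightarrow> P a b = P b a" "\<And>a b. a < k \<Longrightarrow> b < k \<Longrightarrow> 0 \<le> P a b \<and> P a b \<le> 1"
  \<comment> \<open>\<open>n + (k - 1) \<le> k * n\<close> amounts to
    \<open>0 \<le> (k - 1) * (n - 1)\<close>.\<close>
  have sq: "sqrt (real n + real (k - 1)) \<le> sqrt (real k) * sqrt (real n)"
  proof -
    obtain k' n' where "k = Suc k'" "n = Suc n'" using assms a(1) by (cases k; cases n) auto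
    hence "n + (k - 1) \<le> k * n" by (simp add: algebra_simps)
    hence "real n + real (k - 1) \<le> real k * real n" by (metis of_nat_add of_nat_le_iff of_nat_mult)
    thus ?thesis by (simp flip: real_sqrt_mult)
  qed
  have "real n powr (- ((real k * (real k + 2) - 1) / 2)) = 1 / (sqrt (real n) ^ (k - 1) * real n ^ K)"
  proof -
    have "sqrt (real n) ^ (k - 1) = (real n powr (1/2)) powr real (k - 1)"
      using a(1) by (subst powr_realpow) (auto simp: powr_half_sqrt)
    hence "sqrt (real n) ^ (k - 1) * real n ^ K = real n powr (real (k - 1) / 2) * real n powr real K"
      using a(1) by (simp add: powr_powr powr_realpow)
    also have "\<dots> = real n powr ((real k * (real k + 2) - 1) / 2)"
    proof -
      have "real (k - 1) / 2 + real K = (real k * (real k + 2) - 1) / 2"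
        using assms by (simp add: K of_nat_diff) (simp add: field_simps)
      thus ?thesis by (simp only: flip: powr_add)
    qed
    finally have e: "sqrt (real n) ^ (k - 1) * real n ^ K = real n powr ((real k * (real k + 2) - 1) / 2)" .
    show ?thesis unfolding e powr_minus inverse_eq_divide ..
  qed
  hence "C * real n powr (- ((real k * (real k + 2) - 1) / 2))
     = Gamma (real k / 2) / (exp 1 * (sqrt (real k) * sqrt (real n)) ^ (k - 1)) * (1 / (exp 1 * real n)) ^ K"
    by (simp add: C_def power_mult_distrib power_divide)
  also have "\<dots> \<le> Gamma (real k / 2) / (exp 1 * sqrt (real n + real (k - 1)) ^ (k - 1)) * (1 / (exp 1 * real n)) ^ K"
    using sq G assms a(1)
    by (intro mult_right_mono divide_left_mono mult_left_mono power_mono mult_pos_pos zero_less_power) auto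
  finally have "C * real n powr (- ((real k * (real k + 2) - 1) / 2))
    \<le> Gamma (real k / 2) / (exp 1 * sqrt (real n + real (k - 1)) ^ (k - 1)) * (1 / (exp 1 * real n)) ^ K" .
  moreover have "0 \<le> sbm_prob n k \<pi> P (network A)"
    unfolding sbm_prob_eq using a labellings_less
    by (intro sum_nonneg mult_nonneg_nonneg prod_nonneg edge_lik_nonneg) auto
  ultimately have "C * real n powr (- ((real k * (real k + 2) - 1) / 2)) * sbm_prob n k \<pi> P (network A)
    \<le> Gamma (real k / 2) / (exp 1 * sqrt (real n + real (k - 1)) ^ (k - 1)) * (1 / (exp 1 * real n)) ^ K
      * sbm_prob n k \<pi> P (network A)" by (intro mult_right_mono)
  also have "\<dots> \<le> KT n k (network A)" unfolding K_def using assms a by (intro KT_lower_explicit)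
  finally show "C * real n powr (- ((real k * (real k + 2) - 1) / 2)) * sbm_prob n k \<pi> P (network A) \<le> KT n k (network A)" .
qed

text \<open>Comparison with the uniform model, which gives every network positive probability. It
  allows inequalities between the logarithms in the criterion to be exponentiated.\<close>

lemma KT_pos:
  assumes "1 \<le> k" "1 \<le> n" "A \<in> Pow (node_pairs n)"
  shows "0 < KT n k (network A)"
proof -
  obtain C where C: "C > 0" "C * real n powr (- ((real k * (real k + 2) - 1) / 2)) *
      sbm_prob n k (\<lambda>_. 1 / real k) (\<lambda>_ _. 1/2) (network A) \<le> KT n k (network A)"
    by (rule KT_lower[OF assms(1)]) (use assms in force)
  have "labellings n k \<noteq> {}" using assms(1) by (auto simp: labellings_def PiE_eq_empty_iff)
  hence "0 < sbm_prob n k (\<lambda>_. 1 / real k) (\<lambda>_ _. 1/2) (network A)"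
    unfolding sbm_prob_eq edge_lik_def using assms(1) by (intro sum_pos mult_pos_pos prod_pos) auto
  hence "0 < C * real n powr (- ((real k * (real k + 2) - 1) / 2)) *
      sbm_prob n k (\<lambda>_. 1 / real k) (\<lambda>_ _. 1/2) (network A)"
    using C(1) assms(2) by (intro mult_pos_pos) auto
  thus ?thesis using C(2) by linarith
qed

section \<open>Upper bound: a finite grid of maximum likelihood values\<close>

text \<open>All values that a block frequency can take; \<open>m = 0\<close> contributes
  \<open>0 / 0 = 0\<close>, the value produced by an empty block.\<close>

definition freq_grid :: "nat \<Rightarrow> real set" where
  "freq_grid n = (\<lambda>(i, m). real i / real m) ` {(i, m). i \<le> m \<and> m \<le> n\<^sup>2}"

definition grid_params :: "nat \<Rightarrow> nat \<Rightarrow> (nat \<times> nat \<Rightarrow> real) set" where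
  "grid_params n k = pair_idx k \<rightarrow>\<^sub>E freq_grid n"

lemma finite_freq_grid: "finite (freq_grid n)"
  unfolding freq_grid_def
  by (intro finite_imageI, rule finite_subset[of _ "{..n\<^sup>2} \<times> {..n\<^sup>2}"]) auto

lemma finite_grid_params [simp]: "finite (grid_params n k)"
  unfolding grid_params_def by (intro finite_PiE finite_freq_grid finite_pair_idx)

lemma card_grid_params: "card (grid_params n k) \<le> ((n\<^sup>2 + 1)\<^sup>2) ^ card (pair_idx k)"
proof -
  have "card (freq_grid n) \<le> card {(i, m). i \<le> m \<and> m \<le> n\<^sup>2}"
    unfolding freq_grid_def
    by (intro card_image_le, rule finite_subset[of _ "{..n\<^sup>2} \<times> {..n\<^sup>2}"]) auto
  also have "\<dots> \<le> card ({..n\<^sup>2} \<times> {..n\<^sup>2})" by (intro card_mono) auto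
  also have "\<dots> = (n\<^sup>2 + 1)\<^sup>2" by (simp add: card_cartesian_product power2_eq_square)
  finally have "card (freq_grid n) \<le> (n\<^sup>2 + 1)\<^sup>2" .
  thus ?thesis unfolding grid_params_def by (simp add: card_PiE power_mono)
qed

lemma freq_grid_bounds: "q \<in> freq_grid n \<Longrightarrow> 0 \<le> q \<and> q \<le> 1"
  by (auto simp: freq_grid_def divide_le_eq_1)

lemma grid_params_bounds:
  assumes "g \<in> grid_params n k" "a < k" "b < k"
  shows "0 \<le> P_of g a b \<and> P_of g a b \<le> 1"
proof -
  have "(min a b, max a b) \<in> pair_idx k" using assms by (auto simp: pair_idx_def)
  thus ?thesis using assms(1) freq_grid_bounds unfolding P_of_def grid_params_def by (auto simp: PiE_iff)
qed

text \<open>The maximum likelihood value depends on the network, the grid does not. Bounding the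
  maximum by a sum keeps the expression additive for the later exchange with the sum over
  networks.\<close>

lemma edge_lik_le_grid:
  assumes "1 \<le> n" "z \<in> labellings n k" "\<And>p. p \<in> pair_idx k \<Longrightarrow> 0 \<le> v p \<and> v p \<le> 1"
  shows "edge_lik n (P_of v) z x \<le> (\<Sum>g\<in>grid_params n k. edge_lik n (P_of g) z x)"
proof -
  let ?o1 = "block_count n z x" and ?o0 = "block_count n z (\<lambda>i j. \<not> x i j)"
  define g where "g = restrict (\<lambda>p. real (?o1 p) / real (?o1 p + ?o0 p)) (pair_idx k)"
  have g: "g \<in> grid_params n k"
    unfolding grid_params_def
  proof (rule PiE_I)
    fix p assume p: "p \<in> pair_idx k"
    have "(?o1 p, ?o1 p + ?o0 p) \<in> {(i, m). i \<le> m \<and> m \<le> n\<^sup>2}"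
      using block_count_less[OF assms(1), of z x p] by simp
    thus "g p \<in> freq_grid n" unfolding freq_grid_def by (rule rev_image_eqI) (simp add: g_def p)
  qed (simp add: g_def)
  have "edge_lik n (P_of v) z x \<le> edge_lik n (P_of g) z x"
    unfolding edge_lik_P_of[OF assms(2)]
  proof (intro prod_mono conjI)
    fix p assume p: "p \<in> pair_idx k"
    show "0 \<le> v p ^ ?o1 p * (1 - v p) ^ ?o0 p"
      using assms(3)[OF p] by (intro mult_nonneg_nonneg zero_le_power) auto
    show "v p ^ ?o1 p * (1 - v p) ^ ?o0 p \<le> g p ^ ?o1 p * (1 - g p) ^ ?o0 p"
      using binomial_likelihood_le_MLE[of "v p" "?o1 p" "?o0 p"] assms(3)[OF p] p by (simp add: g_def)
  qed
  also have "\<dots> \<le> (\<Sum>g\<in>grid_params n k. edge_lik n (P_of g) z x)"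
    using g by (intro member_le_sum edge_lik_nonneg[OF assms(2)] grid_params_bounds) auto
  finally show ?thesis .
qed

lemma KT_le_grid:
  assumes "1 \<le> k" "1 \<le> n" "A \<in> Pow (node_pairs n)"
  shows "KT n k (network A) \<le> (\<Sum>z\<in>labellings n k. \<Sum>g\<in>grid_params n k. edge_lik n (P_of g) z (network A))"
proof -
  let ?U = "\<lambda>z. \<Sum>g\<in>grid_params n k. edge_lik n (P_of g) z (network A)"
  have U0: "0 \<le> ?U z" if "z \<in> labellings n k" for z
    using that by (intro sum_nonneg edge_lik_nonneg grid_params_bounds)
  have "ennreal (KT n k (network A)) = KT_sum n k (network A)"
    using KT_network assms by simp
  also have "\<dots> \<le> (\<Sum>z\<in>labellings n k. 1 * ennreal (?U z))"
    unfolding KT_sum_def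
  proof (rule sum_mono)
    fix z assume z: "z \<in> labellings n k"
    have "beta_marginal n k z (network A) \<le> ennreal (?U z)"
      using edge_lik_le_grid[OF assms(2) z] U0[OF z] by (rule beta_marginal_le)
    thus "dirichlet_marginal n k z * beta_marginal n k z (network A) \<le> 1 * ennreal (?U z)"
      using dirichlet_marginal_le_1[OF assms(1) z] by (intro mult_mono) simp_all
  qed
  also have "\<dots> = ennreal (\<Sum>z\<in>labellings n k. ?U z)"
    using U0 by (simp add: sum_ennreal)
  finally show ?thesis using U0 by (subst (asm) ennreal_le_iff) (auto intro: sum_nonneg)
qed

section \<open>Hellinger affinity and label discrepancy\<close>

lemma sqrt_prod: "sqrt (\<Prod>x\<in>A. f x) = (\<Prod>x\<in>A. sqrt (f x))"
  by (induction A rule: infinite_finite_induct) (auto simp: real_sqrt_mult)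

text \<open>The first term is rewritten exactly and the second bounded by the inequality of means,
  so only the discrepancy of the edge roots survives; it is the part that scales with the edge
  density.\<close>

lemma bernoulli_affinity_le:
  fixes p q :: real
  assumes "0 \<le> p" "p \<le> 1" "0 \<le> q" "q \<le> 1"
  shows "sqrt (p * q) + sqrt ((1 - p) * (1 - q)) \<le> exp (- ((sqrt p - sqrt q)\<^sup>2 / 2))"
proof -
  have "sqrt (p * q) = (p + q - (sqrt p - sqrt q)\<^sup>2) / 2"
    using assms by (simp add: power2_diff real_sqrt_mult)
  moreover have "sqrt ((1 - p) * (1 - q)) \<le> ((1 - p) + (1 - q)) / 2"
    using assms by (intro arith_geo_mean_sqrt) auto
  ultimately have "sqrt (p * q) + sqrt ((1 - p) * (1 - q)) \<le> 1 + (- ((sqrt p - sqrt q)\<^sup>2 / 2))"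
    by (simp add: field_simps)
  also have "\<dots> \<le> exp (- ((sqrt p - sqrt q)\<^sup>2 / 2))" by (rule exp_ge_add_one_self)
  finally show ?thesis .
qed

definition hellinger_sum ::
  "nat \<Rightarrow> (nat \<Rightarrow> nat \<Rightarrow> real) \<Rightarrow> (nat \<Rightarrow> nat) \<Rightarrow> (nat \<Rightarrow> nat \<Rightarrow> real) \<Rightarrow> (nat \<Rightarrow> nat) \<Rightarrow> real" where
  "hellinger_sum n P z Q y = (\<Sum>e\<in>node_pairs n.
     (sqrt (P (z (fst e)) (z (snd e))) - sqrt (Q (y (fst e)) (y (snd e))))\<^sup>2)"

lemma edge_lik_affinity_le:
  assumes "z \<in> labellings n k" "\<And>a b. a < k \<Longrightarrow> b < k \<Longrightarrow> 0 \<le> P a b \<and> P a b \<le> 1"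
    and "y \<in> labellings n l" "\<And>a b. a < l \<Longrightarrow> b < l \<Longrightarrow> 0 \<le> Q a b \<and> Q a b \<le> 1"
  shows "(\<Sum>A\<in>Pow (node_pairs n). sqrt (edge_lik n P z (network A)) * sqrt (edge_lik n Q y (network A)))
    \<le> exp (- (hellinger_sum n P z Q y / 2))"
proof -
  let ?p = "\<lambda>e. P (z (fst e)) (z (snd e))" and ?q = "\<lambda>e. Q (y (fst e)) (y (snd e))"
  let ?E = "node_pairs n"
  have pq: "0 \<le> ?p e \<and> ?p e \<le> 1 \<and> 0 \<le> ?q e \<and> ?q e \<le> 1" if "e \<in> ?E" for e
    using that assms(2,4) labellings_less[OF assms(1)] labellings_less[OF assms(3)]
    by (auto simp: node_pairs_def)
  have "(\<Sum>A\<in>Pow ?E. sqrt (edge_lik n P z (network A)) * sqrt (edge_lik n Q y (network A)))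
    = (\<Sum>A\<in>Pow ?E. (\<Prod>e\<in>A. sqrt (?p e * ?q e)) * (\<Prod>e\<in>?E - A. sqrt ((1 - ?p e) * (1 - ?q e))))"
  proof (rule sum.cong[OF refl])
    fix A assume "A \<in> Pow ?E"
    hence A: "?E \<inter> {e. e \<in> A} = A" "?E \<inter> - {e. e \<in> A} = ?E - A" by auto
    have "sqrt (edge_lik n P z (network A)) * sqrt (edge_lik n Q y (network A))
      = (\<Prod>e\<in>?E. if e \<in> A then sqrt (?p e * ?q e) else sqrt ((1 - ?p e) * (1 - ?q e)))"
      unfolding edge_lik_def sqrt_prod prod.distrib[symmetric]
      by (rule prod.cong[OF refl]) (simp add: network_def real_sqrt_mult)
    also have "\<dots> = (\<Prod>e\<in>A. sqrt (?p e * ?q e)) * (\<Prod>e\<in>?E - A. sqrt ((1 - ?p e) * (1 - ?q e)))"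
      using A by (simp add: prod.If_cases)
    finally show "sqrt (edge_lik n P z (network A)) * sqrt (edge_lik n Q y (network A))
      = (\<Prod>e\<in>A. sqrt (?p e * ?q e)) * (\<Prod>e\<in>?E - A. sqrt ((1 - ?p e) * (1 - ?q e)))" .
  qed
  also have "\<dots> = (\<Prod>e\<in>?E. sqrt (?p e * ?q e) + sqrt ((1 - ?p e) * (1 - ?q e)))"
    by (rule prod_add[symmetric]) simp
  also have "\<dots> \<le> (\<Prod>e\<in>?E. exp (- ((sqrt (?p e) - sqrt (?q e))\<^sup>2 / 2)))"
  proof (rule prod_mono, rule conjI)
    fix e assume e: "e \<in> ?E"
    show "0 \<le> sqrt (?p e * ?q e) + sqrt ((1 - ?p e) * (1 - ?q e))"
      using pq[OF e] by simp
    show "sqrt (?p e * ?q e) + sqrt ((1 - ?p e) * (1 - ?q e)) \<le> exp (- ((sqrt (?p e) - sqrt (?q e))\<^sup>2 / 2))"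
      using pq[OF e] by (intro bernoulli_affinity_le) auto
  qed
  also have "\<dots> = exp (- (hellinger_sum n P z Q y / 2))"
    by (simp add: hellinger_sum_def exp_sum sum_negf sum_divide_distrib flip: exp_sum)
  finally show ?thesis .
qed

section \<open>Discrepancy caused by too few labels\<close>

text \<open>The pigeonhole argument counts in rectangles of ordered pairs, whereas likelihoods run
  over unordered ones.\<close>

lemma sum_ordered_pairs:
  fixes f :: "nat \<Rightarrow> nat \<Rightarrow> real"
  assumes "\<And>i j. i < n \<Longrightarrow> j < n \<Longrightarrow> f i j = f j i"
  shows "(\<Sum>e\<in>{e \<in> {..<n} \<times> {..<n}. fst e \<noteq> snd e}. f (fst e) (snd e)) = 2 * (\<Sum>e\<in>node_pairs n. f (fst e) (snd e))"
proof -
  have un: "{e \<in> {..<n} \<times> {..<n}. fst e \<noteq> snd e} = node_pairs n \<union> prod.swap ` node_pairs n"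
  proof (intro equalityI subsetI)
    fix e assume "e \<in> {e \<in> {..<n} \<times> {..<n}. fst e \<noteq> snd e}"
    then obtain i j where e: "e = (i, j)" "i < n" "j < n" "i \<noteq> j" by (cases e) auto
    show "e \<in> node_pairs n \<union> prod.swap ` node_pairs n"
    proof (cases "i < j")
      case False
      hence "(j, i) \<in> node_pairs n" using e by (auto simp: node_pairs_def)
      thus ?thesis using e by (auto intro!: rev_image_eqI)
    qed (use e in \<open>auto simp: node_pairs_def\<close>)
  qed (auto simp: node_pairs_def)
  have "(\<Sum>e\<in>prod.swap ` node_pairs n. f (fst e) (snd e)) = (\<Sum>e\<in>node_pairs n. f (snd e) (fst e))"
    by (subst sum.reindex) (auto simp: inj_on_def)
  also have "\<dots> = (\<Sum>e\<in>node_pairs n. f (fst e) (snd e))"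
    by (rule sum.cong[OF refl]) (use assms in \<open>auto simp: node_pairs_def\<close>)
  finally show ?thesis unfolding un
    by (subst sum.union_disjoint) (auto, auto simp: node_pairs_def)
qed

lemma large_cell_exists:
  assumes "z \<in> labellings n l" "1 \<le> l" "finite A" "A \<subseteq> {..<n}"
  obtains b where "b < l" "real (card A) / real l \<le> real (card {i \<in> A. z i = b})"
proof (rule ccontr)
  assume "\<not> thesis"
  hence *: "real (card {i \<in> A. z i = b}) < real (card A) / real l" if "b < l" for b
    using that \<open>\<And>b. \<lbrakk>b < l; real (card A) / real l \<le> real (card {i \<in> A. z i = b})\<rbrakk> \<Longrightarrow> thesis\<close> by force
  have "real (card A) = real (\<Sum>b<l. card {i \<in> A. z i = b})"
  proof -
    have "(\<Sum>b<l. \<Sum>i\<in>{i \<in> A. z i = b}. 1 :: nat) = (\<Sum>i\<in>A. 1)"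
      using labellings_less[OF assms(1)] assms(3,4) by (intro sum.group) auto
    thus ?thesis by simp
  qed
  also have "\<dots> < (\<Sum>b<l. real (card A) / real l)"
    unfolding of_nat_sum using assms(2) * by (intro sum_strict_mono) (auto simp: lessThan_empty_iff)
  also have "\<dots> = real (card A)" using assms(2) by simp
  finally show False by simp
qed

text \<open>The two cells may coincide, but each \<open>i\<close> meets the diagonal at most
  once.\<close>

lemma card_off_diagonal:
  assumes "finite A" "finite C"
  shows "real (card A) * (real (card C) - 1) \<le> real (card {e \<in> A \<times> C. fst e \<noteq> snd e})"
proof -
  have "card (A \<times> C) \<le> card ({e \<in> A \<times> C. fst e \<noteq> snd e} \<union> (\<lambda>i. (i, i)) ` A)"
    using assms by (intro card_mono) auto
  also have "\<dots> \<le> card {e \<in> A \<times> C. fst e \<noteq> snd e} + card ((\<lambda>i. (i, i)) ` A)" by (rule card_Un_le)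
  also have "card ((\<lambda>i. (i, i)) ` A) \<le> card A" using assms by (intro card_image_le)
  finally have "real (card A * card C) \<le> real (card {e \<in> A \<times> C. fst e \<noteq> snd e} + card A)"
    by (simp only: of_nat_le_iff card_cartesian_product)
  thus ?thesis by (simp add: algebra_simps)
qed

text \<open>With fewer fitted labels than true ones, two true communities share a fitted label on
  cells of linear size, and no single fitted parameter can match two different columns.\<close>

lemma pigeonhole_block_discrepancy:
  fixes S T :: "nat \<Rightarrow> nat \<Rightarrow> real"
  assumes z: "z \<in> labellings n k" and y: "y \<in> labellings n l" and l: "1 \<le> l" "l < k"
    and S: "\<And>a b. a < k \<Longrightarrow> b < k \<Longrightarrow> S a b = S b a"
    and T: "\<And>a b. a < l \<Longrightarrow> b < l \<Longrightarrow> T a b = T b a"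
    and sep: "\<And>a b. a < k \<Longrightarrow> b < k \<Longrightarrow> a \<noteq> b \<Longrightarrow> \<exists>c<k. \<eta> \<le> (S a c - S b c)\<^sup>2"
    and m: "\<And>a. a < k \<Longrightarrow> m * real l \<le> real (label_count n z a)" "1 \<le> m"
  shows "m * (m - 1) * \<eta> / 4 \<le> (\<Sum>e\<in>node_pairs n. (S (z (fst e)) (z (snd e)) - T (y (fst e)) (y (snd e)))\<^sup>2)"
proof -
  let ?f = "\<lambda>i j. (S (z i) (z j) - T (y i) (y j))\<^sup>2"
  \<comment> \<open>Some fitted label covers at least the average share of the nodes with true label
    \<open>a\<close>.\<close>
  have "\<exists>b<l. m \<le> real (card {i \<in> {i \<in> {..<n}. z i = a}. y i = b})" if a: "a < k" for a
  proof -
    obtain b where "b < l" "real (card {i \<in> {..<n}. z i = a}) / real l \<le> real (card {i \<in> {i \<in> {..<n}. z i = a}. y i = b})"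
      by (rule large_cell_exists[OF y l(1), of "{i \<in> {..<n}. z i = a}"]) auto
    moreover have "m \<le> real (card {i \<in> {..<n}. z i = a}) / real l"
      using m(1)[OF a] l(1) by (simp add: label_count_def field_simps)
    ultimately show ?thesis by fastforce
  qed
  then obtain \<phi> where \<phi>: "\<And>a. a < k \<Longrightarrow> \<phi> a < l"
    "\<And>a. a < k \<Longrightarrow> m \<le> real (card {i \<in> {i \<in> {..<n}. z i = a}. y i = \<phi> a})" by metis
  define cell where "cell a = {i \<in> {..<n}. z i = a \<and> y i = \<phi> a}" for a
  have cell: "m \<le> real (card (cell a))" if "a < k" for a
  proof -
    have "{i \<in> {i \<in> {..<n}. z i = a}. y i = \<phi> a} = cell a" by (auto simp: cell_def)
    thus ?thesis using \<phi>(2)[OF that] by simp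
  qed
  have fin: "finite (cell a)" for a by (simp add: cell_def)
  have "\<not> inj_on \<phi> {..<k}"
  proof
    assume "inj_on \<phi> {..<k}"
    hence "card {..<k} \<le> card {..<l}" by (rule card_inj_on_le) (use \<phi>(1) in auto)
    thus False using l by simp
  qed
  then obtain a b where ab: "a < k" "b < k" "a \<noteq> b" "\<phi> a = \<phi> b" by (auto simp: inj_on_def)
  then obtain c where c: "c < k" "\<eta> \<le> (S a c - S b c)\<^sup>2" using sep by blast
  \<comment> \<open>Since \<open>\<phi> a = \<phi> b\<close>, the fit has this single value on both
    rectangles, where the truth is \<open>S a c\<close> and \<open>S b c\<close>.\<close>
  define t where "t = T (\<phi> a) (\<phi> c)"
  define off where "off d = {e \<in> cell d \<times> cell c. fst e \<noteq> snd e}" for d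
  have cnt: "m * (m - 1) \<le> real (card (off d))" if "d < k" for d
  proof -
    have "m * (m - 1) \<le> real (card (cell d)) * (real (card (cell c)) - 1)"
      using cell[OF that] cell[OF c(1)] m(2) by (intro mult_mono) auto
    also have "\<dots> \<le> real (card (off d))" unfolding off_def by (intro card_off_diagonal fin)
    finally show ?thesis .
  qed
  have fo: "finite (off d)" for d
    unfolding off_def by (rule finite_subset[of _ "cell d \<times> cell c"]) (use fin in auto)
  have sm: "(\<Sum>e\<in>off d. ?f (fst e) (snd e)) = real (card (off d)) * (S d c - t)\<^sup>2" if "\<phi> d = \<phi> a" for d
  proof -
    have "(\<Sum>e\<in>off d. ?f (fst e) (snd e)) = (\<Sum>e\<in>off d. (S d c - t)\<^sup>2)"
      by (rule sum.cong[OF refl]) (auto simp: off_def cell_def t_def that)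
    thus ?thesis by simp
  qed
  \<comment> \<open>One number cannot be close to two separated ones; the midpoint is the best
    choice. The factor 2 here and the factor 2 between ordered and unordered pairs make the 4 of the
    claim.\<close>
  have par: "(u - w)\<^sup>2 / 2 \<le> (u - t)\<^sup>2 + (w - t)\<^sup>2" for u w :: real
  proof -
    have "0 \<le> ((u - t) + (w - t))\<^sup>2" by simp
    thus ?thesis by (simp add: power2_eq_square field_simps)
  qed
  have m0: "0 \<le> m * (m - 1)" using m(2) by simp
  have "m * (m - 1) * \<eta> / 2 \<le> m * (m - 1) * ((S a c - t)\<^sup>2 + (S b c - t)\<^sup>2)"
  proof -
    have "\<eta> / 2 \<le> (S a c - t)\<^sup>2 + (S b c - t)\<^sup>2" using par[of "S a c" "S b c"] c(2) by linarith
    from mult_left_mono[OF this m0] show ?thesis by simp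
  qed
  also have "\<dots> \<le> real (card (off a)) * (S a c - t)\<^sup>2 + real (card (off b)) * (S b c - t)\<^sup>2"
    unfolding distrib_left using ab by (intro add_mono mult_right_mono cnt) auto
  also have "\<dots> = (\<Sum>e\<in>off a. ?f (fst e) (snd e)) + (\<Sum>e\<in>off b. ?f (fst e) (snd e))"
    using sm[of a] sm[of b] ab(4) by simp
  also have "\<dots> = (\<Sum>e\<in>off a \<union> off b. ?f (fst e) (snd e))"
    using ab(3) by (intro sum.union_disjoint[symmetric] fo) (auto simp: off_def cell_def)
  also have "\<dots> \<le> (\<Sum>e\<in>{e \<in> {..<n} \<times> {..<n}. fst e \<noteq> snd e}. ?f (fst e) (snd e))"
    by (rule sum_mono2) (auto simp: off_def cell_def)
  also have "\<dots> = 2 * (\<Sum>e\<in>node_pairs n. ?f (fst e) (snd e))"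
  proof (rule sum_ordered_pairs)
    fix i j assume "i < n" "j < n"
    hence "S (z i) (z j) = S (z j) (z i)" "T (y i) (y j) = T (y j) (y i)"
      using labellings_less[OF z] labellings_less[OF y] S T by blast+
    thus "?f i j = ?f j i" by simp
  qed
  finally show ?thesis by simp
qed

section \<open>Typical true labels\<close>

text \<open>A Chernoff bound with tilting factor \<open>exp (-1)\<close>. As
  \<open>1 - exp (-1)\<close> is at least \<open>1/2\<close>, weights above
  \<open>4 * \<delta>\<close> make the tilted total at most \<open>exp (- 2 * \<delta>)\<close>;
  half of this exponent pays for the threshold factor \<open>exp (\<delta> * n)\<close>.\<close>

lemma rare_label_prob:
  fixes \<pi> :: "nat \<Rightarrow> real"
  assumes \<pi>: "\<And>a. a < k \<Longrightarrow> 4 * \<delta> \<le> \<pi> a" "(\<Sum>a<k. \<pi> a) = 1" and \<delta>: "0 < \<delta>" and a: "a < k"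
  shows "(\<Sum>z\<in>{z \<in> labellings n k. real (label_count n z a) < \<delta> * real n}. \<Prod>i<n. \<pi> (z i)) \<le> exp (- (\<delta> * real n))"
proof -
  have \<pi>0: "0 \<le> \<pi> b" if "b < k" for b using \<pi>(1)[OF that] \<delta> by linarith
  define \<sigma> where "\<sigma> b = (if b = a then \<pi> b * exp (-1) else \<pi> b)" for b
  have p0: "0 \<le> (\<Prod>i<n. \<pi> (z i))" if "z \<in> labellings n k" for z
    using labellings_less[OF that] \<pi>0 by (intro prod_nonneg) auto
  have tilt: "(\<Prod>i<n. \<sigma> (z i)) = (\<Prod>i<n. \<pi> (z i)) * exp (- real (label_count n z a))" for z
  proof -
    have "(\<Prod>i<n. \<sigma> (z i)) = (\<Prod>i<n. \<pi> (z i) * (if z i = a then exp (-1) else 1))"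
      by (rule prod.cong[OF refl]) (simp add: \<sigma>_def)
    also have "\<dots> = (\<Prod>i<n. \<pi> (z i)) * (\<Prod>i<n. if z i = a then exp (-1) else 1)"
      by (rule prod.distrib)
    also have "(\<Prod>i<n. if z i = a then exp (-1) else 1) = exp (-1 :: real) ^ label_count n z a"
      by (subst prod.If_cases) (auto simp: label_count_def Collect_conj_eq lessThan_def)
    also have "\<dots> = exp (- real (label_count n z a))" by (simp flip: exp_of_nat_mult)
    finally show ?thesis .
  qed
  have "(\<Sum>z\<in>{z \<in> labellings n k. real (label_count n z a) < \<delta> * real n}. \<Prod>i<n. \<pi> (z i))
     \<le> (\<Sum>z\<in>{z \<in> labellings n k. real (label_count n z a) < \<delta> * real n}. exp (\<delta> * real n) * (\<Prod>i<n. \<sigma> (z i)))"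
  proof (rule sum_mono)
    fix z assume z: "z \<in> {z \<in> labellings n k. real (label_count n z a) < \<delta> * real n}"
    hence "1 \<le> exp (\<delta> * real n) * exp (- real (label_count n z a))"
      by (simp flip: exp_add)
    hence "(\<Prod>i<n. \<pi> (z i)) * 1 \<le> (\<Prod>i<n. \<pi> (z i)) * (exp (\<delta> * real n) * exp (- real (label_count n z a)))"
      using z p0 by (intro mult_left_mono) auto
    thus "(\<Prod>i<n. \<pi> (z i)) \<le> exp (\<delta> * real n) * (\<Prod>i<n. \<sigma> (z i))"
      unfolding tilt by (simp add: mult_ac)
  qed
  also have "\<dots> \<le> (\<Sum>z\<in>labellings n k. exp (\<delta> * real n) * (\<Prod>i<n. \<sigma> (z i)))"
    unfolding tilt using p0 by (intro sum_mono2) (auto intro!: mult_nonneg_nonneg)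
  also have "\<dots> = exp (\<delta> * real n) * (\<Sum>b<k. \<sigma> b) ^ n"
    by (simp only: sum_distrib_left[symmetric] sum_prod_labels)
  also have "\<dots> \<le> exp (\<delta> * real n) * exp (- (2 * \<delta>)) ^ n"
  proof (intro mult_left_mono power_mono)
    have "(\<Sum>b<k. \<sigma> b) = (\<Sum>b<k. \<pi> b - (if b = a then \<pi> a * (1 - exp (-1)) else 0))"
      by (rule sum.cong[OF refl]) (simp add: \<sigma>_def algebra_simps)
    also have "\<dots> = 1 - \<pi> a * (1 - exp (-1))"
      using a \<pi>(2) by (simp add: sum_subtractf)
    also have "\<dots> \<le> 1 - 2 * \<delta>"
    proof -
      have "exp (-1 :: real) \<le> 1/2"
        using exp_ge_add_one_self[of 1] by (simp add: exp_minus field_simps)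
      hence "4 * \<delta> * (1/2) \<le> \<pi> a * (1 - exp (-1))"
        using \<pi>(1)[OF a] \<delta> by (intro mult_mono) auto
      thus ?thesis by simp
    qed
    also have "\<dots> \<le> exp (- (2 * \<delta>))" using exp_ge_add_one_self[of "- (2 * \<delta>)"] by simp
    finally show "(\<Sum>b<k. \<sigma> b) \<le> exp (- (2 * \<delta>))" .
    show "0 \<le> (\<Sum>b<k. \<sigma> b)" using \<pi>0 by (intro sum_nonneg) (auto simp: \<sigma>_def)
  qed simp
  also have "\<dots> = exp (- (\<delta> * real n))"
    by (simp flip: exp_of_nat_mult exp_add)
  finally show ?thesis .
qed

section \<open>Over- and underestimation\<close>

definition edge_set :: "nat \<Rightarrow> (nat \<Rightarrow> nat \<Rightarrow> bool) \<Rightarrow> (nat \<times> nat) set" where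
  "edge_set n x = {e \<in> node_pairs n. x (fst e) (snd e)}"

lemma sbm_prob_network_edge_set: "sbm_prob n k \<pi> P (network (edge_set n x)) = sbm_prob n k \<pi> P x"
proof -
  have "edge_lik n P z (network (edge_set n x)) = edge_lik n P z x" for z
    unfolding edge_lik_def by (rule prod.cong[OF refl]) (auto simp: network_def edge_set_def)
  thus ?thesis by (simp add: sbm_prob_eq)
qed

lemma k_KT_network_edge_set: "k_KT \<epsilon> n (network (edge_set n x)) = k_KT \<epsilon> n x"
  unfolding k_KT_def KT_crit_def KT_def sbm_prob_network_edge_set ..

text \<open>An order that strictly beats all others is the unique maximiser, hence the one that
  \<open>LEAST\<close> selects. The contrapositive also covers networks whose criterion has no
  maximiser.\<close>

lemma k_KT_neq_imp:
  assumes "1 \<le> k0" "k_KT \<epsilon> n x \<noteq> k0"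
  shows "\<exists>k\<ge>1. k \<noteq> k0 \<and> KT_crit \<epsilon> n x k0 \<le> KT_crit \<epsilon> n x k"
proof (rule ccontr)
  assume "\<not> ?thesis"
  hence *: "KT_crit \<epsilon> n x k < KT_crit \<epsilon> n x k0" if "1 \<le> k" "k \<noteq> k0" for k
    using that by (meson not_le_imp_less)
  have "k_KT \<epsilon> n x = k0"
    unfolding k_KT_def
  proof (rule Least_equality)
    show "1 \<le> k0 \<and> (\<forall>k'\<ge>1. KT_crit \<epsilon> n x k' \<le> KT_crit \<epsilon> n x k0)"
      using assms(1) * by (metis less_imp_le order_refl)
    show "k0 \<le> k" if "1 \<le> k \<and> (\<forall>k'\<ge>1. KT_crit \<epsilon> n x k' \<le> KT_crit \<epsilon> n x k)" for k
      using that * assms(1) by (metis not_le order_refl)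
  qed
  thus False using assms(2) by simp
qed

definition pen_coeff :: "real \<Rightarrow> nat \<Rightarrow> real" where
  "pen_coeff \<epsilon> k = (\<Sum>i=1..k-1. (real i * (real i + 2) + 3 + \<epsilon>) / 2)"

lemma pen_eq: "pen \<epsilon> k n = pen_coeff \<epsilon> k * ln (real n)"
  unfolding pen_def pen_coeff_def sum_distrib_right ..

lemma pen_coeff_Suc:
  assumes "1 \<le> k"
  shows "pen_coeff \<epsilon> (Suc k) = pen_coeff \<epsilon> k + (real k * (real k + 2) + 3 + \<epsilon>) / 2"
proof -
  obtain j where "k = Suc j" using assms by (cases k) auto
  thus ?thesis by (simp add: pen_coeff_def)
qed

text \<open>The increment at \<open>k0\<close> cancels \<open>k0 * (k0 + 2) / 2\<close> and leaves
  \<open>- (1 + 3 + \<epsilon>) / 2\<close>, which is below \<open>- 2\<close>; every further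
  increment is at least 1.\<close>

lemma pen_coeff_gap:
  assumes "1 \<le> k0" "k0 < k" "0 < \<epsilon>"
  shows "(real k0 * (real k0 + 2) - 1) / 2 + pen_coeff \<epsilon> k0 - pen_coeff \<epsilon> k \<le> - 2 - real (k - k0 - 1)"
proof -
  have "Suc k0 \<le> k" using assms(2) by simp
  thus ?thesis
  proof (induction k rule: dec_induct)
    case base
    show ?case using pen_coeff_Suc[OF assms(1)] assms(3) by (simp add: field_simps)
  next
    case (step j)
    have "1 \<le> (real j * (real j + 2) + 3 + \<epsilon>) / 2" using assms(3) by (simp add: add_nonneg_nonneg)
    moreover have "pen_coeff \<epsilon> (Suc j) = pen_coeff \<epsilon> j + (real j * (real j + 2) + 3 + \<epsilon>) / 2"
      using step(1) by (intro pen_coeff_Suc) simp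
    moreover have "real (Suc j - k0 - 1) = real (j - k0 - 1) + 1" using step(1) by simp
    ultimately show ?case using step.IH by linarith
  qed
qed

lemma KT_le_of_crit_le:
  assumes "1 \<le> n" "0 < KT n k x" "0 < KT n k0 x" "KT_crit \<epsilon> n x k0 \<le> KT_crit \<epsilon> n x k"
  shows "KT n k0 x \<le> real n powr (pen_coeff \<epsilon> k0 - pen_coeff \<epsilon> k) * KT n k x"
proof -
  have "ln (KT n k0 x) \<le> (pen_coeff \<epsilon> k0 - pen_coeff \<epsilon> k) * ln (real n) + ln (KT n k x)"
    using assms(4) unfolding KT_crit_def pen_eq by (simp add: algebra_simps)
  hence "exp (ln (KT n k0 x)) \<le> exp ((pen_coeff \<epsilon> k0 - pen_coeff \<epsilon> k) * ln (real n) + ln (KT n k x))"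
    by (subst exp_le_cancel_iff)
  thus ?thesis using assms(1-3) by (simp add: exp_add powr_def)
qed

text \<open>Serves both directions: for \<open>k > k0\<close> the exponent of \<open>n\<close> is at
  most \<open>- 2\<close>, for \<open>k < k0\<close> it is some constant, and such a polynomial
  factor is absorbed by the exponential decay.\<close>

lemma sbm_prob_le_of_crit_le:
  assumes "1 \<le> n" "1 \<le> k" "1 \<le> k0" "A \<in> Pow (node_pairs n)" "0 < C"
    and lower: "C * real n powr (- d) * p \<le> KT n k0 (network A)"
    and crit: "KT_crit \<epsilon> n (network A) k0 \<le> KT_crit \<epsilon> n (network A) k"
  shows "p \<le> 1 / C * real n powr (d + pen_coeff \<epsilon> k0 - pen_coeff \<epsilon> k) * KT n k (network A)"
proof -
  let ?r = "real n powr (pen_coeff \<epsilon> k0 - pen_coeff \<epsilon> k)"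
  have "C * real n powr (- d) * p \<le> ?r * KT n k (network A)"
    using lower KT_le_of_crit_le[OF assms(1) KT_pos[OF assms(2,1,4)] KT_pos[OF assms(3,1,4)] crit] by linarith
  hence "(1 / C * real n powr d) * (C * real n powr (- d) * p) \<le> (1 / C * real n powr d) * (?r * KT n k (network A))"
    using assms(5) by (intro mult_left_mono) auto
  moreover have "(1 / C * real n powr d) * (C * real n powr (- d) * p) = p"
    using assms(1,5) by (simp add: powr_minus field_simps)
  moreover have "real n powr d * ?r = real n powr (d + pen_coeff \<epsilon> k0 - pen_coeff \<epsilon> k)"
    by (simp flip: powr_add add: algebra_simps)
  moreover have "(1 / C * real n powr d) * (?r * KT n k (network A))
      = 1 / C * (real n powr d * ?r) * KT n k (network A)" by (simp only: mult.assoc)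
  ultimately show ?thesis by (simp only:)
qed

section \<open>Orders above the true one\<close>

lemma overestimation_sum:
  fixes p :: "(nat \<times> nat) set \<Rightarrow> real"
  assumes "1 \<le> k0" "2 \<le> n" "0 < C" "0 < \<epsilon>"
    and lower: "\<And>A. A \<in> Pow (node_pairs n) \<Longrightarrow>
      C * real n powr (- ((real k0 * (real k0 + 2) - 1) / 2)) * p A \<le> KT n k0 (network A)"
  shows "(\<Sum>A\<in>{A \<in> Pow (node_pairs n). \<exists>k>k0. KT_crit \<epsilon> n (network A) k0 \<le> KT_crit \<epsilon> n (network A) k}. p A)
    \<le> 2 / C * (1 / (real n)\<^sup>2)"
proof -
  define B where "B = {A \<in> Pow (node_pairs n). \<exists>k>k0. KT_crit \<epsilon> n (network A) k0 \<le> KT_crit \<epsilon> n (network A) k}"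
  have finB: "finite B" by (simp add: B_def)
  \<comment> \<open>One winning order per network suffices, and as there are finitely many networks,
    only finitely many orders occur: the union over all \<open>k > k0\<close> becomes a finite
    sum.\<close>
  define \<kappa> where "\<kappa> A = (SOME k. k0 < k \<and> KT_crit \<epsilon> n (network A) k0 \<le> KT_crit \<epsilon> n (network A) k)" for A
  have \<kappa>: "k0 < \<kappa> A" "KT_crit \<epsilon> n (network A) k0 \<le> KT_crit \<epsilon> n (network A) (\<kappa> A)" if "A \<in> B" for A
    using that someI_ex[of "\<lambda>k. k0 < k \<and> KT_crit \<epsilon> n (network A) k0 \<le> KT_crit \<epsilon> n (network A) k"]
    unfolding B_def \<kappa>_def by auto
  \<comment> \<open>Each order beyond \<open>k0 + 1\<close> gains a factor \<open>1 / n\<close>,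
    relaxed to \<open>1/2\<close> by \<open>2 \<le> n\<close>; the geometric series is the source of
    the 2 in the bound.\<close>
  let ?q = "\<lambda>k. 1 / C * (1 / (real n)\<^sup>2) * (1/2) ^ (k - k0 - 1)"
  have KT0: "0 \<le> KT n k x" for k x by (simp add: KT_def)
  have "p A \<le> (\<Sum>k\<in>\<kappa> ` B. ?q k * KT n k (network A))" if A: "A \<in> B" for A
  proof -
    have AP: "A \<in> Pow (node_pairs n)" using A by (simp add: B_def)
    let ?d = "(real k0 * (real k0 + 2) - 1) / 2"
    have "p A \<le> 1 / C * real n powr (?d + pen_coeff \<epsilon> k0 - pen_coeff \<epsilon> (\<kappa> A)) * KT n (\<kappa> A) (network A)"
      using assms \<kappa>[OF A] by (intro sbm_prob_le_of_crit_le lower AP) auto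
    also have "\<dots> \<le> 1 / C * (1 / (real n)\<^sup>2 * (1/2) ^ (\<kappa> A - k0 - 1)) * KT n (\<kappa> A) (network A)"
    proof (intro mult_right_mono mult_left_mono KT0)
      have "real n powr (?d + pen_coeff \<epsilon> k0 - pen_coeff \<epsilon> (\<kappa> A)) \<le> real n powr (- 2 - real (\<kappa> A - k0 - 1))"
        using assms \<kappa>[OF A] by (intro powr_mono pen_coeff_gap) auto
      also have "\<dots> = real n powr (- real 2) * real n powr (- real (\<kappa> A - k0 - 1))"
        by (subst powr_add[symmetric]) simp
      also have "\<dots> = 1 / (real n)\<^sup>2 * (1 / real n) ^ (\<kappa> A - k0 - 1)"
        using assms(2) unfolding powr_minus by (subst (1 2) powr_realpow) (auto simp: field_simps)
      also have "\<dots> \<le> 1 / (real n)\<^sup>2 * (1/2) ^ (\<kappa> A - k0 - 1)"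
        using assms(2) by (intro mult_left_mono power_mono) (auto simp: field_simps)
      finally show "real n powr (?d + pen_coeff \<epsilon> k0 - pen_coeff \<epsilon> (\<kappa> A)) \<le> 1 / (real n)\<^sup>2 * (1/2) ^ (\<kappa> A - k0 - 1)" .
    qed (use assms in auto)
    also have "\<dots> = ?q (\<kappa> A) * KT n (\<kappa> A) (network A)" by simp
    also have "\<dots> \<le> (\<Sum>k\<in>\<kappa> ` B. ?q k * KT n k (network A))"
      using A assms finB by (intro member_le_sum mult_nonneg_nonneg KT0) auto
    finally show ?thesis .
  qed
  hence "(\<Sum>A\<in>B. p A) \<le> (\<Sum>A\<in>B. \<Sum>k\<in>\<kappa> ` B. ?q k * KT n k (network A))" by (rule sum_mono)
  also have "\<dots> \<le> (\<Sum>A\<in>Pow (node_pairs n). \<Sum>k\<in>\<kappa> ` B. ?q k * KT n k (network A))"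
    using assms by (intro sum_mono2 sum_nonneg mult_nonneg_nonneg KT0) (auto simp: B_def)
  also have "\<dots> = (\<Sum>k\<in>\<kappa> ` B. ?q k * (\<Sum>A\<in>Pow (node_pairs n). KT n k (network A)))"
    unfolding sum_distrib_left by (rule sum.swap)
  also have "\<dots> = (\<Sum>k\<in>\<kappa> ` B. ?q k)"
  proof (rule sum.cong[OF refl])
    fix k assume "k \<in> \<kappa> ` B"
    hence "1 \<le> k" using \<kappa>(1) by fastforce
    thus "?q k * (\<Sum>A\<in>Pow (node_pairs n). KT n k (network A)) = ?q k" by (simp only: sum_KT_networks mult_1_right)
  qed
  also have "\<dots> = 1 / C * (1 / (real n)\<^sup>2) * (\<Sum>k\<in>\<kappa> ` B. (1/2) ^ (k - k0 - 1))"
    by (simp only: sum_distrib_left)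
  also have "(\<Sum>k\<in>\<kappa> ` B. (1/2 :: real) ^ (k - k0 - 1)) \<le> 2"
  proof -
    have "inj_on (\<lambda>k. k - k0 - 1) (\<kappa> ` B)"
    proof (rule inj_onI)
      fix a b assume "a \<in> \<kappa> ` B" "b \<in> \<kappa> ` B" "a - k0 - 1 = b - k0 - 1"
      moreover from this have "k0 < a" "k0 < b" using \<kappa>(1) by auto
      ultimately show "a = b" by linarith
    qed
    hence "(\<Sum>k\<in>\<kappa> ` B. (1/2 :: real) ^ (k - k0 - 1)) = (\<Sum>j\<in>(\<lambda>k. k - k0 - 1) ` \<kappa> ` B. (1/2) ^ j)"
      by (simp add: sum.reindex)
    also have "\<dots> \<le> (\<Sum>j. (1/2 :: real) ^ j)"
      using finB by (intro sum_le_suminf summable_geometric) auto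
    also have "\<dots> = 2" by (subst suminf_geometric) auto
    finally show ?thesis .
  qed
  hence "1 / C * (1 / (real n)\<^sup>2) * (\<Sum>k\<in>\<kappa> ` B. (1/2 :: real) ^ (k - k0 - 1)) \<le> 1 / C * (1 / (real n)\<^sup>2) * 2"
    using assms by (intro mult_left_mono) auto
  finally show ?thesis by (simp add: B_def)
qed

section \<open>Orders below the true one\<close>

lemma sum_le_sum_UN:
  fixes f :: "'a \<Rightarrow> real"
  assumes "finite I" "\<And>i. i \<in> I \<Longrightarrow> finite (F i)" "A \<subseteq> (\<Union>i\<in>I. F i)" "\<And>x. x \<in> (\<Union>i\<in>I. F i) \<Longrightarrow> 0 \<le> f x"
  shows "sum f A \<le> (\<Sum>i\<in>I. sum f (F i))"
proof -
  have "sum f A \<le> sum f (\<Union>i\<in>I. F i)" using assms by (intro sum_mono2) auto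
  also have "\<dots> \<le> (\<Sum>i\<in>I. sum f (F i))"
    using assms(1,2,4)
  proof (induction I rule: finite_induct)
    case (insert i I)
    have "sum f (F i \<union> (\<Union>i\<in>I. F i)) + sum f (F i \<inter> (\<Union>i\<in>I. F i)) = sum f (F i) + sum f (\<Union>i\<in>I. F i)"
      using insert by (intro sum.union_inter) auto
    moreover have "0 \<le> sum f (F i \<inter> (\<Union>i\<in>I. F i))" using insert.prems by (intro sum_nonneg) auto
    moreover have "sum f (\<Union>i\<in>I. F i) \<le> (\<Sum>i\<in>I. sum f (F i))" using insert by auto
    ultimately show ?case using insert.hyps by simp
  qed simp
  finally show ?thesis .
qed

lemma sqrt_sum_le_sum_sqrt:
  assumes "\<And>x. x \<in> A \<Longrightarrow> 0 \<le> f x"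
  shows "sqrt (\<Sum>x\<in>A. f x) \<le> (\<Sum>x\<in>A. sqrt (f x))"
  using assms
proof (induction A rule: infinite_finite_induct)
  case (insert x A)
  have "sqrt (f x + (\<Sum>x\<in>A. f x)) \<le> sqrt (f x) + sqrt (\<Sum>x\<in>A. f x)"
    using insert.prems by (intro sqrt_add_le_add_sqrt sum_nonneg) auto
  thus ?case using insert by fastforce
qed auto

text \<open>A Chernoff-type bound: on the event where the true likelihood is at most \<open>R\<close> times the
  mixture, each labelled likelihood is dominated by a geometric mean, so that the sum over networks
  becomes a Hellinger affinity.\<close>

lemma underestimation_sum:
  fixes \<pi> :: "nat \<Rightarrow> real" and P :: "nat \<Rightarrow> nat \<Rightarrow> real"
  assumes k: "1 \<le> k" and k0: "1 \<le> k0" and n: "1 \<le> n" and lam: "0 \<le> R" and \<delta>: "0 < \<delta>"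
    and \<pi>: "\<And>a. a < k0 \<Longrightarrow> 4 * \<delta> \<le> \<pi> a" "(\<Sum>a<k0. \<pi> a) = 1"
    and P: "\<And>a b. a < k0 \<Longrightarrow> b < k0 \<Longrightarrow> 0 \<le> P a b \<and> P a b \<le> 1"
    and B: "B \<subseteq> Pow (node_pairs n)"
      "\<And>A. A \<in> B \<Longrightarrow> sbm_prob n k0 \<pi> P (network A) \<le> R * KT n k (network A)"
    and h: "\<And>z y g. \<lbrakk>z \<in> labellings n k0; \<And>a. a < k0 \<Longrightarrow> \<delta> * real n \<le> real (label_count n z a);
        y \<in> labellings n k; g \<in> grid_params n k\<rbrakk> \<Longrightarrow> h \<le> hellinger_sum n P z (P_of g) y"
  shows "(\<Sum>A\<in>B. sbm_prob n k0 \<pi> P (network A)) \<le> real k0 * exp (- (\<delta> * real n)) +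
    sqrt R * (real (k0 ^ n) * real (k ^ n) * real (card (grid_params n k))) * exp (- (h / 2))"
proof -
  define w where "w z = (\<Prod>i<n. \<pi> (z i))" for z
  let ?e = "\<lambda>z A. edge_lik n P z (network A)"
  let ?u = "\<lambda>y g A. edge_lik n (P_of g) y (network A)"
  let ?L = "labellings n k0"
  define typical where "typical = {z \<in> ?L. \<forall>a<k0. \<delta> * real n \<le> real (label_count n z a)}"
  define atypical where "atypical = ?L - typical"
  have finB: "finite B" using B(1) by (rule finite_subset) simp
  have \<pi>0: "0 \<le> \<pi> a" if "a < k0" for a using \<pi>(1)[OF that] \<delta> by linarith
  have w0: "0 \<le> w z" if "z \<in> ?L" for z
    unfolding w_def using labellings_less[OF that] \<pi>0 by (intro prod_nonneg) auto
  have w1: "w z \<le> 1" if "z \<in> ?L" for z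
  proof -
    have "w z \<le> (\<Sum>z\<in>?L. w z)" using that w0 by (intro member_le_sum) auto
    thus ?thesis unfolding w_def using sum_prod_labels[where \<pi> = \<pi> and n = n and k = k0] \<pi>(2) by simp
  qed
  have e0: "0 \<le> ?e z A" if "z \<in> ?L" for z A using that P by (rule edge_lik_nonneg)
  have u0: "0 \<le> ?u y g A" if "y \<in> labellings n k" "g \<in> grid_params n k" for y g A
    using that(1) grid_params_bounds[OF that(2)] by (rule edge_lik_nonneg)
  have sub: "typical \<subseteq> ?L" by (auto simp: typical_def)
  have eB: "(\<Sum>A\<in>B. ?e z A) \<le> 1" if "z \<in> ?L" for z
  proof -
    have "(\<Sum>A\<in>B. ?e z A) \<le> (\<Sum>A\<in>Pow (node_pairs n). ?e z A)"
      using B(1) e0[OF that] by (intro sum_mono2) auto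
    thus ?thesis by (simp add: sum_edge_lik_networks)
  qed
  have atypical: "(\<Sum>z\<in>atypical. \<Sum>A\<in>B. w z * ?e z A) \<le> real k0 * exp (- (\<delta> * real n))"
  proof -
    have "(\<Sum>z\<in>atypical. \<Sum>A\<in>B. w z * ?e z A) \<le> (\<Sum>z\<in>atypical. w z)"
    proof (rule sum_mono)
      fix z assume "z \<in> atypical"
      hence z: "z \<in> ?L" by (simp add: atypical_def)
      show "(\<Sum>A\<in>B. w z * ?e z A) \<le> w z"
        using mult_left_mono[OF eB[OF z] w0[OF z]] by (simp add: sum_distrib_left)
    qed
    also have "\<dots> \<le> (\<Sum>a\<in>{..<k0}. \<Sum>z\<in>{z \<in> ?L. real (label_count n z a) < \<delta> * real n}. w z)"
      by (rule sum_le_sum_UN) (auto simp: atypical_def typical_def not_le intro!: w0)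
    also have "\<dots> \<le> (\<Sum>a\<in>{..<k0}. exp (- (\<delta> * real n)))"
      unfolding w_def using \<pi> \<delta> by (intro sum_mono rare_label_prob) auto
    finally show ?thesis by simp
  qed
  have typical: "(\<Sum>z\<in>typical. \<Sum>A\<in>B. w z * ?e z A)
    \<le> sqrt R * (real (k0 ^ n) * real (k ^ n) * real (card (grid_params n k))) * exp (- (h / 2))"
  proof -
    let ?G = "grid_params n k"
    have "(\<Sum>A\<in>B. w z * ?e z A) \<le> sqrt R * (real (k ^ n) * real (card ?G) * exp (- (h / 2)))" if zt: "z \<in> typical" for z
    proof -
      have z: "z \<in> ?L" using zt sub by auto
      \<comment> \<open>The term is at most \<open>?e z A\<close> and at most \<open>R * ?U\<close>,
        hence at most their geometric mean. The weight is given up through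
        \<open>w z \<le> 1\<close>, which costs the number \<open>k0 ^ n\<close> of labellings in
        the final bound.\<close>
      have pt: "w z * ?e z A \<le> (\<Sum>y\<in>labellings n k. \<Sum>g\<in>?G. sqrt R * (sqrt (?e z A) * sqrt (?u y g A)))" if A: "A \<in> B" for A
      proof -
        let ?t = "w z * ?e z A"
        let ?U = "\<Sum>y\<in>labellings n k. \<Sum>g\<in>?G. ?u y g A"
        have t0: "0 \<le> ?t" using w0[OF z] e0[OF z] by simp
        have "?t \<le> sbm_prob n k0 \<pi> P (network A)"
          unfolding sbm_prob_eq w_def[symmetric]
          using z w0 e0 by (intro member_le_sum[of z ?L "\<lambda>z. w z * ?e z A"]) auto
        also have "\<dots> \<le> R * KT n k (network A)" by (rule B(2)[OF A])
        also have "\<dots> \<le> R * ?U"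
          using A B(1) lam k n by (intro mult_left_mono KT_le_grid) auto
        finally have t1: "?t \<le> R * ?U" .
        have t2: "?t \<le> ?e z A" using mult_right_mono[OF w1[OF z] e0[OF z]] by simp
        have "?t = sqrt ?t * sqrt ?t" using t0 by simp
        also have "\<dots> \<le> sqrt (?e z A) * sqrt (R * ?U)"
          using t0 t1 t2 e0[OF z] by (intro mult_mono) auto
        also have "\<dots> = sqrt R * sqrt (?e z A) * sqrt ?U" by (simp add: real_sqrt_mult)
        also have "\<dots> \<le> sqrt R * sqrt (?e z A) * (\<Sum>y\<in>labellings n k. \<Sum>g\<in>?G. sqrt (?u y g A))"
        proof (rule mult_left_mono)
          \<comment> \<open>Subadditivity of the root breaks the mixture bound into affinities with
            single product measures.\<close>
          have "sqrt ?U \<le> (\<Sum>y\<in>labellings n k. sqrt (\<Sum>g\<in>?G. ?u y g A))"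
            using u0 by (intro sqrt_sum_le_sum_sqrt sum_nonneg)
          also have "\<dots> \<le> (\<Sum>y\<in>labellings n k. \<Sum>g\<in>?G. sqrt (?u y g A))"
            using u0 by (intro sum_mono sqrt_sum_le_sum_sqrt)
          finally show "sqrt ?U \<le> (\<Sum>y\<in>labellings n k. \<Sum>g\<in>?G. sqrt (?u y g A))" .
        qed (use lam e0[OF z] in simp)
        finally show ?thesis by (simp only: sum_distrib_left mult.assoc)
      qed
      have "(\<Sum>A\<in>B. w z * ?e z A)
         \<le> (\<Sum>A\<in>B. \<Sum>y\<in>labellings n k. \<Sum>g\<in>?G. sqrt R * (sqrt (?e z A) * sqrt (?u y g A)))"
        by (rule sum_mono[OF pt])
      also have "\<dots> \<le> (\<Sum>A\<in>Pow (node_pairs n). \<Sum>y\<in>labellings n k. \<Sum>g\<in>?G. sqrt R * (sqrt (?e z A) * sqrt (?u y g A)))"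
        using B(1) lam e0[OF z] u0 by (intro sum_mono2 sum_nonneg mult_nonneg_nonneg) auto
      also have "\<dots> = (\<Sum>y\<in>labellings n k. \<Sum>g\<in>?G. \<Sum>A\<in>Pow (node_pairs n). sqrt R * (sqrt (?e z A) * sqrt (?u y g A)))"
        by (subst sum.swap) (rule sum.cong[OF refl], rule sum.swap)
      also have "\<dots> \<le> (\<Sum>y\<in>labellings n k. \<Sum>g\<in>?G. sqrt R * exp (- (h / 2)))"
      proof (rule sum_mono, rule sum_mono)
        fix y g assume y: "y \<in> labellings n k" and g: "g \<in> ?G"
        have "(\<Sum>A\<in>Pow (node_pairs n). sqrt (?e z A) * sqrt (?u y g A)) \<le> exp (- (hellinger_sum n P z (P_of g) y / 2))"
          using z P y grid_params_bounds[OF g] by (rule edge_lik_affinity_le)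
        also have "\<dots> \<le> exp (- (h / 2))" using h[OF z _ y g] zt by (simp add: typical_def)
        finally show "(\<Sum>A\<in>Pow (node_pairs n). sqrt R * (sqrt (?e z A) * sqrt (?u y g A))) \<le> sqrt R * exp (- (h / 2))"
          unfolding sum_distrib_left[symmetric] using lam by (intro mult_left_mono) auto
      qed
      also have "\<dots> = sqrt R * (real (k ^ n) * real (card ?G) * exp (- (h / 2)))"
        by (simp add: card_labellings mult_ac)
      finally show ?thesis .
    qed
    hence "(\<Sum>z\<in>typical. \<Sum>A\<in>B. w z * ?e z A) \<le> (\<Sum>z\<in>typical. sqrt R * (real (k ^ n) * real (card ?G) * exp (- (h / 2))))"
      by (rule sum_mono)
    also have "\<dots> \<le> (\<Sum>z\<in>?L. sqrt R * (real (k ^ n) * real (card ?G) * exp (- (h / 2))))"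
      using lam sub by (intro sum_mono2) auto
    also have "\<dots> = sqrt R * (real (k0 ^ n) * real (k ^ n) * real (card ?G)) * exp (- (h / 2))"
      by (simp add: card_labellings mult_ac)
    finally show ?thesis .
  qed
  have "(\<Sum>A\<in>B. sbm_prob n k0 \<pi> P (network A)) = (\<Sum>z\<in>?L. \<Sum>A\<in>B. w z * ?e z A)"
    unfolding sbm_prob_eq w_def by (rule sum.swap)
  also have "\<dots> = (\<Sum>z\<in>atypical. \<Sum>A\<in>B. w z * ?e z A) + (\<Sum>z\<in>typical. \<Sum>A\<in>B. w z * ?e z A)"
    unfolding atypical_def by (rule sum.subset_diff[OF sub]) simp
  finally show ?thesis using atypical typical by linarith
qed

section \<open>Almost sure consistency\<close>

lemma eventually_power_le_exp: "eventually (\<lambda>n. B * real n ^ J \<le> exp (real n)) sequentially"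
proof -
  have "((\<lambda>n. real n ^ J / exp (real n)) \<longlongrightarrow> 0) sequentially"
    using filterlim_compose[OF tendsto_power_div_exp_0 filterlim_real_sequentially] by simp
  hence "((\<lambda>n. B * (real n ^ J / exp (real n))) \<longlongrightarrow> B * 0) sequentially"
    by (intro tendsto_mult tendsto_const)
  hence "eventually (\<lambda>n. B * (real n ^ J / exp (real n)) < 1) sequentially"
    by (intro order_tendstoD(2)[of _ "B * 0"]) auto
  thus ?thesis by eventually_elim (simp add: field_simps)
qed

lemma eventually_prefactor_le_exp:
  assumes "0 \<le> C"
  shows "eventually (\<lambda>n. sqrt (C * real n powr D) * real (((n\<^sup>2 + 1)\<^sup>2) ^ K) \<le> exp (real n)) sequentially"
proof -
  define J where "J = nat \<lceil>\<bar>D\<bar>\<rceil>"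
  have "eventually (\<lambda>n. (1 + C) * 4 ^ K * real n ^ (J + 4 * K) \<le> exp (real n)) sequentially"
    by (rule eventually_power_le_exp)
  thus ?thesis using eventually_ge_at_top[of 1]
  proof eventually_elim
    case (elim n)
    have nJ: "1 \<le> real n ^ J" using elim(2) by (intro one_le_power) simp
    have "D \<le> real J" unfolding J_def by linarith
    hence "real n powr D \<le> real n powr real J" using elim(2) by (intro powr_mono) auto
    hence "C * real n powr D \<le> C * real n ^ J"
      using elim(2) assms by (intro mult_left_mono) (auto simp: powr_realpow)
    hence "sqrt (C * real n powr D) \<le> sqrt (C * real n ^ J)" by simp
    also have "\<dots> \<le> 1 + C * real n ^ J"
      using assms by (intro real_le_lsqrt) (auto simp: power2_eq_square algebra_simps)
    also have "\<dots> \<le> (1 + C) * real n ^ J" using nJ by (simp add: algebra_simps)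
    finally have 1: "sqrt (C * real n powr D) \<le> (1 + C) * real n ^ J" .
    have "n\<^sup>2 + 1 \<le> 2 * n\<^sup>2" using elim(2) by simp
    hence "((n\<^sup>2 + 1)\<^sup>2) ^ K \<le> ((2 * n\<^sup>2)\<^sup>2) ^ K" by (intro power_mono) auto
    also have "\<dots> = 4 ^ K * n ^ (4 * K)" by (simp add: power_mult_distrib power_mult[symmetric])
    finally have "real (((n\<^sup>2 + 1)\<^sup>2) ^ K) \<le> real (4 ^ K * n ^ (4 * K))" by (rule of_nat_mono)
    hence 2: "real (((n\<^sup>2 + 1)\<^sup>2) ^ K) \<le> 4 ^ K * real n ^ (4 * K)" by simp
    have "sqrt (C * real n powr D) * real (((n\<^sup>2 + 1)\<^sup>2) ^ K) \<le> ((1 + C) * real n ^ J) * (4 ^ K * real n ^ (4 * K))"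
      using assms by (intro mult_mono 1 2) auto
    also have "\<dots> = (1 + C) * 4 ^ K * real n ^ (J + 4 * K)" by (simp only: power_add mult_ac)
    finally show ?case using elim(1) by linarith
  qed
qed

text \<open>The budget: \<open>exp n\<close> covers the polynomial factors,
  \<open>exp (n * l)\<close> counts the pairs of labellings, and another \<open>exp n\<close> is
  kept as decay. Hence the exponent must reach \<open>n * (2 + l)\<close>.\<close>

lemma eventually_underestimation_rate:
  fixes \<rho> :: "nat \<Rightarrow> real"
  assumes "0 \<le> C" "0 < c" "0 < \<eta>" "\<And>n. 0 < \<rho> n" "1 \<le> k0" "1 \<le> k"
    and lim: "filterlim (\<lambda>n. real n * \<rho> n) at_top sequentially"
  shows "eventually (\<lambda>n. sqrt (C * real n powr D) * (real (k0 ^ n) * real (k ^ n) * real (card (grid_params n k))) *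
      exp (- ((c * real n * (c * real n - 1) * (\<rho> n * \<eta>) / 4) / 2)) \<le> exp (- real n)) sequentially"
proof -
  define l where "l = ln (real k0 * real k)"
  define K where "K = card (pair_idx k)"
  \<comment> \<open>Once \<open>2 \<le> c * n\<close>, the factor \<open>c * n - 1\<close> is at
    least \<open>c * n / 2\<close>, so the exponent is at least
    \<open>c^2 * \<eta> / 16 * n * (n * \<rho> n)\<close>; the threshold is read off from
    this.\<close>
  have "eventually (\<lambda>n. (2 + l) * 16 / (c\<^sup>2 * \<eta>) \<le> real n * \<rho> n) sequentially"
    using lim by (simp add: filterlim_at_top)
  moreover have "eventually (\<lambda>n. 2 / c \<le> real n) sequentially"
    using filterlim_real_sequentially by (simp add: filterlim_at_top)
  ultimately show ?thesis using eventually_prefactor_le_exp[OF assms(1), of D K]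
  proof eventually_elim
    case (elim n)
    let ?s = "sqrt (C * real n powr D)"
    have cn: "2 \<le> c * real n" using elim(2) assms(2) by (simp add: field_simps)
    have pre: "?s * (real (k0 ^ n) * real (k ^ n) * real (card (grid_params n k))) \<le> exp (real n) * exp (real n * l)"
    proof -
      have "real (card (grid_params n k)) \<le> real (((n\<^sup>2 + 1)\<^sup>2) ^ K)"
        unfolding K_def by (intro of_nat_mono card_grid_params)
      hence "?s * real (card (grid_params n k)) \<le> ?s * real (((n\<^sup>2 + 1)\<^sup>2) ^ K)"
        using assms(1) by (intro mult_left_mono) auto
      hence "?s * real (card (grid_params n k)) \<le> exp (real n)" using elim(3) by linarith
      moreover have "real (k0 ^ n) * real (k ^ n) = exp (real n * l)"
      proof -
        have "exp (real n * l) = (real k0 * real k) ^ n"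
          unfolding l_def using assms(5,6) by (subst exp_of_nat_mult) simp
        thus ?thesis by (simp add: power_mult_distrib)
      qed
      ultimately have "(?s * real (card (grid_params n k))) * (real (k0 ^ n) * real (k ^ n)) \<le> exp (real n) * exp (real n * l)"
        by (simp only:) (rule mult_right_mono, auto)
      thus ?thesis by (simp only: mult_ac)
    qed
    have "real n * (2 + l) \<le> c * real n * (c * real n - 1) * (\<rho> n * \<eta>) / 4 / 2"
    proof -
      have "2 + l \<le> c\<^sup>2 * \<eta> / 16 * (real n * \<rho> n)"
        using elim(1) assms(2,3) by (simp add: field_simps)
      hence "real n * (2 + l) \<le> real n * (c\<^sup>2 * \<eta> / 16 * (real n * \<rho> n))" by (rule mult_left_mono) simp
      also have "\<dots> = (c * real n * (c * real n / 2)) * (\<rho> n * \<eta> / 8)" by (simp add: power2_eq_square)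
      also have "\<dots> \<le> (c * real n * (c * real n - 1)) * (\<rho> n * \<eta> / 8)"
        using cn assms(3) assms(4)[of n] by (intro mult_right_mono mult_left_mono) auto
      finally show ?thesis by simp
    qed
    hence "?s * (real (k0 ^ n) * real (k ^ n) * real (card (grid_params n k))) *
        exp (- ((c * real n * (c * real n - 1) * (\<rho> n * \<eta>) / 4) / 2))
      \<le> (exp (real n) * exp (real n * l)) * exp (- (real n * (2 + l)))"
      by (intro mult_mono pre) auto
    also have "\<dots> = exp (- real n)" by (simp add: algebra_simps flip: exp_add)
    finally show ?case .
  qed
qed

text \<open>Distinct entries have distinct roots, and finitely many positive gaps have a positive
  minimum. Inserting 1 keeps the set nonempty when there is a single community.\<close>

lemma column_separation:
  fixes S :: "nat \<Rightarrow> nat \<Rightarrow> real"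
  assumes "\<forall>a<k. \<forall>b<k. 0 \<le> S a b" "\<forall>a<k. \<forall>b<k. a \<noteq> b \<longrightarrow> (\<exists>c<k. S a c \<noteq> S b c)"
  obtains \<eta> where "0 < \<eta>" "\<And>a b. a < k \<Longrightarrow> b < k \<Longrightarrow> a \<noteq> b \<Longrightarrow> \<exists>c<k. \<eta> \<le> (sqrt (S a c) - sqrt (S b c))\<^sup>2"
proof
  let ?D = "(\<lambda>(a, b, c). (sqrt (S a c) - sqrt (S b c))\<^sup>2) ` ({..<k} \<times> {..<k} \<times> {..<k}) - {0}"
  have fin: "finite (insert 1 ?D)" by simp
  have "Min (insert 1 ?D) \<in> insert 1 ?D" using fin by (intro Min_in) auto
  thus "0 < Min (insert 1 ?D)" by (auto simp: less_le)
  fix a b assume ab: "a < k" "b < k" "a \<noteq> b"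
  then obtain c where c: "c < k" "S a c \<noteq> S b c" using assms(2) by blast
  have "(sqrt (S a c) - sqrt (S b c))\<^sup>2 \<in> ?D" using ab c by force
  hence "Min (insert 1 ?D) \<le> (sqrt (S a c) - sqrt (S b c))\<^sup>2" using fin by (intro Min_le) auto
  thus "\<exists>c<k. Min (insert 1 ?D) \<le> (sqrt (S a c) - sqrt (S b c))\<^sup>2" using c by blast
qed

text \<open>The factor \<open>sqrt r\<close> comes out of every root difference of the truth, so the
  separation is \<open>r * \<eta>\<close> with \<eta> independent of \<open>n\<close>. The fitted
  values enter only through symmetry, whatever their scale.\<close>

lemma hellinger_sum_lower:
  fixes S :: "nat \<Rightarrow> nat \<Rightarrow> real"
  assumes "0 < r" "1 \<le> k" "k < k0" "z \<in> labellings n k0" "y \<in> labellings n k"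
    and S: "\<And>a b. a < k0 \<Longrightarrow> b < k0 \<Longrightarrow> S a b = S b a"
    and sep: "\<And>a b. a < k0 \<Longrightarrow> b < k0 \<Longrightarrow> a \<noteq> b \<Longrightarrow> \<exists>c<k0. \<eta> \<le> (sqrt (S a c) - sqrt (S b c))\<^sup>2"
    and m: "\<And>a. a < k0 \<Longrightarrow> m * real k \<le> real (label_count n z a)" "1 \<le> m"
  shows "m * (m - 1) * (r * \<eta>) / 4 \<le> hellinger_sum n (\<lambda>a b. r * S a b) z (P_of g) y"
  unfolding hellinger_sum_def
proof (rule pigeonhole_block_discrepancy[where k = k0 and l = k and S = "\<lambda>a b. sqrt (r * S a b)"
      and T = "\<lambda>a b. sqrt (P_of g a b)", OF assms(4,5,2,3)])
  fix a b assume ab: "a < k0" "b < k0"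
  show "sqrt (r * S a b) = sqrt (r * S b a)" using S[OF ab] by simp
  assume "a \<noteq> b"
  then obtain c where c: "c < k0" "\<eta> \<le> (sqrt (S a c) - sqrt (S b c))\<^sup>2" using sep ab by blast
  have "(sqrt (r * S a c) - sqrt (r * S b c))\<^sup>2 = (sqrt r)\<^sup>2 * (sqrt (S a c) - sqrt (S b c))\<^sup>2"
    by (simp add: real_sqrt_mult power_mult_distrib flip: right_diff_distrib)
  also have "\<dots> = r * (sqrt (S a c) - sqrt (S b c))\<^sup>2" using assms(1) by simp
  finally have "r * \<eta> \<le> (sqrt (r * S a c) - sqrt (r * S b c))\<^sup>2"
    using c(2) assms(1) by simp
  thus "\<exists>c<k0. r * \<eta> \<le> (sqrt (r * S a c) - sqrt (r * S b c))\<^sup>2" using c(1) by blast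
qed (use m P_of_sym in auto)

section \<open>Summable error probabilities\<close>

lemma wrong_order_networks_sum:
  fixes \<rho> :: "nat \<Rightarrow> real" and S :: "nat \<Rightarrow> nat \<Rightarrow> real"
  assumes k0: "1 \<le> k0" and \<pi>: "\<forall>a<k0. 0 < \<pi> a" "(\<Sum>a<k0. \<pi> a) = 1"
    and \<rho>: "\<And>n. 0 < \<rho> n" "filterlim (\<lambda>n. real n * \<rho> n) at_top sequentially"
    and S: "\<forall>a<k0. \<forall>b<k0. 0 \<le> S a b \<and> S a b = S b a" "\<forall>n. \<forall>a<k0. \<forall>b<k0. \<rho> n * S a b \<le> 1"
      "\<forall>a<k0. \<forall>b<k0. a \<noteq> b \<longrightarrow> (\<exists>c<k0. S a c \<noteq> S b c)"
    and \<epsilon>: "0 < \<epsilon>"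
  obtains r where "summable r" "eventually (\<lambda>n.
    (\<Sum>A\<in>{A \<in> Pow (node_pairs n). k_KT \<epsilon> n (network A) \<noteq> k0}. sbm_prob n k0 \<pi> (\<lambda>a b. \<rho> n * S a b) (network A)) \<le> r n) sequentially"
proof -
  obtain \<eta> where \<eta>: "0 < \<eta>" "\<And>a b. a < k0 \<Longrightarrow> b < k0 \<Longrightarrow> a \<noteq> b \<Longrightarrow> \<exists>c<k0. \<eta> \<le> (sqrt (S a c) - sqrt (S b c))\<^sup>2"
    using column_separation[of k0 S] S by (metis (no_types, lifting))
  \<comment> \<open>A quarter of the smallest weight, as the tilting bound asks for
    \<open>4 * \<delta> \<le> \<pi> a\<close>.\<close>
  define \<delta> where "\<delta> = Min (\<pi> ` {..<k0}) / 4"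
  have ne: "\<pi> ` {..<k0} \<noteq> {}" using k0 by (auto simp: lessThan_empty_iff)
  have "Min (\<pi> ` {..<k0}) \<in> \<pi> ` {..<k0}" using ne by (intro Min_in) auto
  hence \<delta>0: "0 < \<delta>" using \<pi>(1) by (auto simp: \<delta>_def)
  have \<delta>: "4 * \<delta> \<le> \<pi> a" if "a < k0" for a using that by (auto simp: \<delta>_def)
  define P where "P n = (\<lambda>a b. \<rho> n * S a b)" for n
  have P: "0 \<le> P n a b \<and> P n a b \<le> 1" "P n a b = P n b a" if "a < k0" "b < k0" for n a b
    using that S \<rho>(1)[of n] by (auto simp: P_def)
  define p where "p n A = sbm_prob n k0 \<pi> (P n) (network A)" for n A
  have p0: "0 \<le> p n A" for n A
    unfolding p_def sbm_prob_eq using P(1) labellings_less \<pi>(1)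
    by (intro sum_nonneg mult_nonneg_nonneg prod_nonneg edge_lik_nonneg) (auto intro: less_imp_le)
  define d where "d = (real k0 * (real k0 + 2) - 1) / 2"
  obtain C where C: "C > 0" "\<And>n A. 1 \<le> n \<Longrightarrow> A \<in> Pow (node_pairs n) \<Longrightarrow> C * real n powr (- d) * p n A \<le> KT n k0 (network A)"
  proof (rule KT_lower[OF k0])
    fix C assume C: "C > 0" "\<And>n A \<pi> P. \<lbrakk>1 \<le> n; A \<in> Pow (node_pairs n); \<And>a. a < k0 \<Longrightarrow> 0 \<le> \<pi> a; (\<Sum>a<k0. \<pi> a) = 1;
      \<And>a b. a < k0 \<Longrightarrow> b < k0 \<Longrightarrow> P a b = P b a; \<And>a b. a < k0 \<Longrightarrow> b < k0 \<Longrightarrow> 0 \<le> P a b \<and> P a b \<le> 1\<rbrakk>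
      \<Longrightarrow> C * real n powr (- ((real k0 * (real k0 + 2) - 1) / 2)) * sbm_prob n k0 \<pi> P (network A) \<le> KT n k0 (network A)"
    have "C * real n powr (- d) * p n A \<le> KT n k0 (network A)" if "1 \<le> n" "A \<in> Pow (node_pairs n)" for n A
      unfolding d_def p_def
    proof (rule C(2)[OF that])
      show "0 \<le> \<pi> a" if "a < k0" for a using \<pi>(1) that by (simp add: less_imp_le)
    qed (use \<pi>(2) P in blast)+
    thus thesis using that C(1) by blast
  qed
  define over where "over n = {A \<in> Pow (node_pairs n). \<exists>k>k0. KT_crit \<epsilon> n (network A) k0 \<le> KT_crit \<epsilon> n (network A) k}" for n
  define under where "under n k = {A \<in> Pow (node_pairs n). KT_crit \<epsilon> n (network A) k0 \<le> KT_crit \<epsilon> n (network A) k}" for n k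
  have ev_under: "eventually (\<lambda>n. (\<Sum>A\<in>under n k. p n A) \<le> real k0 * exp (- (\<delta> * real n)) + exp (- real n)) sequentially"
    if k: "k \<in> {1..<k0}" for k
  proof -
    define D where "D = d + pen_coeff \<epsilon> k0 - pen_coeff \<epsilon> k"
    \<comment> \<open>A typical community has at least \<open>\<delta> * n\<close> nodes, so the
      largest of its \<open>k\<close> fitted cells has at least \<open>c * n\<close>.\<close>
    define c where "c = \<delta> / real k"
    have c: "0 < c" using k \<delta>0 by (simp add: c_def)
    have "eventually (\<lambda>n. sqrt (1 / C * real n powr D) * (real (k0 ^ n) * real (k ^ n) * real (card (grid_params n k))) *
      exp (- ((c * real n * (c * real n - 1) * (\<rho> n * \<eta>) / 4) / 2)) \<le> exp (- real n)) sequentially"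
      using C(1) c \<eta>(1) \<rho> k0 k by (intro eventually_underestimation_rate) auto
    moreover have "eventually (\<lambda>n. 1 / c \<le> real n) sequentially"
      using filterlim_real_sequentially by (simp add: filterlim_at_top)
    ultimately show ?thesis using eventually_ge_at_top[of 1]
    proof eventually_elim
      case (elim n)
      have "(\<Sum>A\<in>under n k. sbm_prob n k0 \<pi> (P n) (network A)) \<le> real k0 * exp (- (\<delta> * real n)) +
        sqrt (1 / C * real n powr D) * (real (k0 ^ n) * real (k ^ n) * real (card (grid_params n k))) *
        exp (- ((c * real n * (c * real n - 1) * (\<rho> n * \<eta>) / 4) / 2))"
      proof (rule underestimation_sum)
        show "1 \<le> k" "1 \<le> k0" "1 \<le> n" "0 < \<delta>" "(\<Sum>a<k0. \<pi> a) = 1" "0 \<le> 1 / C * real n powr D"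
          using k k0 elim(3) \<delta>0 \<pi>(2) C(1) by auto
        show "under n k \<subseteq> Pow (node_pairs n)" by (auto simp: under_def)
        show "4 * \<delta> \<le> \<pi> a" if "a < k0" for a using \<delta>[OF that] .
        show "0 \<le> P n a b \<and> P n a b \<le> 1" if "a < k0" "b < k0" for a b using P(1)[OF that] .
        show "sbm_prob n k0 \<pi> (P n) (network A) \<le> 1 / C * real n powr D * KT n k (network A)" if A: "A \<in> under n k" for A
          unfolding D_def p_def[symmetric] using A k k0 elim(3) C by (intro sbm_prob_le_of_crit_le) (auto simp: under_def)
        fix z y g
        assume z: "z \<in> labellings n k0" "\<And>a. a < k0 \<Longrightarrow> \<delta> * real n \<le> real (label_count n z a)"
          and y: "y \<in> labellings n k" "g \<in> grid_params n k"
        show "c * real n * (c * real n - 1) * (\<rho> n * \<eta>) / 4 \<le> hellinger_sum n (P n) z (P_of g) y"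
          unfolding P_def
        proof (rule hellinger_sum_lower[where k = k and ?k0.0 = k0])
          show "c * real n * real k \<le> real (label_count n z a)" if "a < k0" for a
            using z(2)[OF that] k by (simp add: c_def)
          show "1 \<le> c * real n" using elim(2) c by (simp add: field_simps)
        qed (use \<rho>(1) k z(1) y(1) S \<eta>(2) in auto)
      qed
      thus ?case using elim(1) unfolding p_def by linarith
    qed
  qed
  define r where "r n = 2 / C * (1 / (real n)\<^sup>2) + (\<Sum>k\<in>{1..<k0}. real k0 * exp (- (\<delta> * real n)) + exp (- real n))" for n
  have "summable r"
  proof -
    have g: "summable (\<lambda>n. exp (- (s * real n)))" if "0 < s" for s :: real
    proof -
      have "(\<lambda>n. exp (- (s * real n))) = (\<lambda>n. exp (- s) ^ n)" by (simp flip: exp_of_nat_mult add: mult.commute)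
      thus ?thesis using that by (simp add: summable_geometric)
    qed
    have "summable (\<lambda>n. 1 / (real n)\<^sup>2)"
      using inverse_power_summable[of 2, where ?'a = real] by (simp add: inverse_eq_divide)
    thus ?thesis unfolding r_def using g[OF \<delta>0] g[of 1]
      by (intro summable_add summable_sum summable_mult) auto
  qed
  moreover have "eventually (\<lambda>n. (\<Sum>A\<in>{A \<in> Pow (node_pairs n). k_KT \<epsilon> n (network A) \<noteq> k0}. p n A) \<le> r n) sequentially"
  proof -
    \<comment> \<open>Only finitely many orders lie below \<open>k0\<close>, so one threshold for
      \<open>n\<close> serves all of them.\<close>
    have "eventually (\<lambda>n. \<forall>k\<in>{1..<k0}. (\<Sum>A\<in>under n k. p n A) \<le> real k0 * exp (- (\<delta> * real n)) + exp (- real n)) sequentially"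
      using ev_under by (intro eventually_ball_finite) auto
    thus ?thesis using eventually_ge_at_top[of 2]
    proof eventually_elim
      case (elim n)
      \<comment> \<open>Orders start at 1, so the index 0 is free to stand for
        overestimation.\<close>
      define F where "F i = (if i = 0 then over n else under n i)" for i :: nat
      have "(\<Sum>A\<in>{A \<in> Pow (node_pairs n). k_KT \<epsilon> n (network A) \<noteq> k0}. p n A) \<le> (\<Sum>i\<in>insert 0 {1..<k0}. \<Sum>A\<in>F i. p n A)"
      proof (rule sum_le_sum_UN)
        show "{A \<in> Pow (node_pairs n). k_KT \<epsilon> n (network A) \<noteq> k0} \<subseteq> (\<Union>i\<in>insert 0 {1..<k0}. F i)"
        proof
          fix A assume A: "A \<in> {A \<in> Pow (node_pairs n). k_KT \<epsilon> n (network A) \<noteq> k0}"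
          then obtain k where k: "1 \<le> k" "k \<noteq> k0" "KT_crit \<epsilon> n (network A) k0 \<le> KT_crit \<epsilon> n (network A) k"
            using k_KT_neq_imp[OF k0] by blast
          show "A \<in> (\<Union>i\<in>insert 0 {1..<k0}. F i)"
          proof (cases "k0 < k")
            case True
            hence "A \<in> F 0" using A k by (auto simp: F_def over_def)
            thus ?thesis by blast
          next
            case False
            hence "A \<in> F k" "k \<in> {1..<k0}" using A k by (auto simp: F_def under_def)
            thus ?thesis by blast
          qed
        qed
      qed (auto simp: F_def over_def under_def p0)
      also have "\<dots> = (\<Sum>A\<in>over n. p n A) + (\<Sum>k\<in>{1..<k0}. \<Sum>A\<in>under n k. p n A)"
        by (simp add: F_def)
      also have "\<dots> \<le> r n"
        unfolding r_def
      proof (rule add_mono)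
        show "(\<Sum>A\<in>over n. p n A) \<le> 2 / C * (1 / (real n)\<^sup>2)"
          unfolding over_def using C elim(2) k0 \<epsilon> by (intro overestimation_sum) (auto simp: d_def)
        show "(\<Sum>k\<in>{1..<k0}. \<Sum>A\<in>under n k. p n A) \<le> (\<Sum>k\<in>{1..<k0}. real k0 * exp (- (\<delta> * real n)) + exp (- real n))"
          using elim(1) by (intro sum_mono) auto
      qed
      finally show ?case .
    qed
  qed
  ultimately show thesis using that unfolding p_def P_def by blast
qed

text \<open>An event that depends on the edge set alone is a finite disjoint union of cylinders, so
  its measurability and its probability follow from the law of this single network.\<close>

lemma measure_network_event:
  fixes X :: "'w \<Rightarrow> nat \<Rightarrow> nat \<Rightarrow> bool" and Q :: "(nat \<Rightarrow> nat \<Rightarrow> bool) \<Rightarrow> bool"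
  assumes "prob_space M"
    and meas: "\<forall>x. {w \<in> space M. \<forall>i j. i < j \<and> j < n \<longrightarrow> X w i j = x i j} \<in> sets M"
    and law: "\<forall>x. measure M {w \<in> space M. \<forall>i j. i < j \<and> j < n \<longrightarrow> X w i j = x i j} = q x"
    and Q: "\<And>x. Q (network (edge_set n x)) = Q x"
  shows "{w \<in> space M. Q (X w)} \<in> sets M"
    and "measure M {w \<in> space M. Q (X w)} = (\<Sum>A\<in>{A \<in> Pow (node_pairs n). Q (network A)}. q (network A))"
proof -
  interpret prob_space M by fact
  let ?cyl = "\<lambda>A. {w \<in> space M. \<forall>i j. i < j \<and> j < n \<longrightarrow> X w i j = network A i j}"
  let ?I = "{A \<in> Pow (node_pairs n). Q (network A)}"
  have cyl: "?cyl A = {w \<in> space M. edge_set n (X w) = A}" if "A \<in> Pow (node_pairs n)" for A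
  proof -
    have "(\<forall>i j. i < j \<and> j < n \<longrightarrow> x i j = network A i j) \<longleftrightarrow> edge_set n x = A" for x
    proof
      assume x: "\<forall>i j. i < j \<and> j < n \<longrightarrow> x i j = network A i j"
      show "edge_set n x = A"
      proof (rule set_eqI)
        fix e :: "nat \<times> nat"
        obtain i j where e: "e = (i, j)" by (cases e)
        have "(i, j) \<in> A \<Longrightarrow> i < j \<and> j < n" using that by (auto simp: node_pairs_def)
        thus "e \<in> edge_set n x \<longleftrightarrow> e \<in> A" using x unfolding e edge_set_def node_pairs_def network_def by auto
      qed
    next
      assume A: "edge_set n x = A"
      show "\<forall>i j. i < j \<and> j < n \<longrightarrow> x i j = network A i j"
        unfolding A[symmetric] edge_set_def node_pairs_def network_def by simp
    qed
    thus ?thesis by simp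
  qed
  have edge_set_Pow: "edge_set n x \<in> Pow (node_pairs n)" for x by (auto simp: edge_set_def)
  have eq: "{w \<in> space M. Q (X w)} = (\<Union>A\<in>?I. ?cyl A)"
  proof (intro equalityI subsetI)
    fix w assume w: "w \<in> {w \<in> space M. Q (X w)}"
    hence "edge_set n (X w) \<in> ?I" using Q edge_set_Pow by auto
    moreover have "w \<in> ?cyl (edge_set n (X w))" using w cyl[OF edge_set_Pow] by simp
    ultimately show "w \<in> (\<Union>A\<in>?I. ?cyl A)" by blast
  next
    fix w assume "w \<in> (\<Union>A\<in>?I. ?cyl A)"
    then obtain A where A: "A \<in> ?I" "w \<in> ?cyl A" by blast
    hence "w \<in> space M" "edge_set n (X w) = A" using cyl[of A] by auto
    thus "w \<in> {w \<in> space M. Q (X w)}" using A(1) Q[of "X w"] by simp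
  qed
  show "{w \<in> space M. Q (X w)} \<in> sets M" unfolding eq by (rule sets.finite_UN) (simp, rule spec[OF meas])
  have "disjoint_family_on ?cyl ?I"
    unfolding disjoint_family_on_def
  proof (intro ballI impI)
    fix A B assume A: "A \<in> ?I" "B \<in> ?I" "A \<noteq> B"
    hence P: "A \<in> Pow (node_pairs n)" "B \<in> Pow (node_pairs n)" by blast+
    show "?cyl A \<inter> ?cyl B = {}" unfolding cyl[OF P(1)] cyl[OF P(2)] using A(3) by blast
  qed
  moreover have "?cyl ` ?I \<subseteq> sets M" using spec[OF meas] by (rule image_subsetI)
  moreover have "finite ?I" by simp
  ultimately have "measure M (\<Union>A\<in>?I. ?cyl A) = (\<Sum>A\<in>?I. measure M (?cyl A))"
    by (intro finite_measure_finite_Union)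
  also have "\<dots> = (\<Sum>A\<in>?I. q (network A))" by (rule sum.cong[OF refl]) (rule spec[OF law])
  finally show "measure M {w \<in> space M. Q (X w)} = (\<Sum>A\<in>?I. q (network A))"
    unfolding eq .
qed

theorem theorem1:
  fixes M :: "'w measure"
    and X :: "nat \<Rightarrow> 'w \<Rightarrow> nat \<Rightarrow> nat \<Rightarrow> bool"
    and k0 :: nat
    and \<pi>0 :: "nat \<Rightarrow> real"
    and Pn :: "nat \<Rightarrow> nat \<Rightarrow> nat \<Rightarrow> real"
    and \<epsilon> :: real
  assumes "prob_space M"
    and "1 \<le> k0"
    and "\<forall>a<k0. 0 < \<pi>0 a" and "(\<Sum>a<k0. \<pi>0 a) = 1"
    and regime:
      "(\<exists>P0. (\<forall>n. Pn n = P0)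
             \<and> (\<forall>a<k0. \<forall>b<k0. 0 \<le> P0 a b \<and> P0 a b \<le> 1 \<and> P0 a b = P0 b a)
             \<and> (\<forall>a<k0. \<forall>b<k0. a \<noteq> b \<longrightarrow> (\<exists>c<k0. P0 a c \<noteq> P0 b c)))
       \<or> (\<exists>S0 \<rho>. (\<forall>n. Pn n = (\<lambda>a b. \<rho> n * S0 a b))
             \<and> (\<forall>n. 0 < \<rho> n)
             \<and> \<rho> \<longlonglongrightarrow> 0
             \<and> filterlim (\<lambda>n. real n * \<rho> n) at_top sequentially
             \<and> (\<forall>a<k0. \<forall>b<k0. 0 \<le> S0 a b \<and> S0 a b = S0 b a)
             \<and> (\<forall>n. \<forall>a<k0. \<forall>b<k0. \<rho> n * S0 a b \<le> 1)
             \<and> (\<forall>a<k0. \<forall>b<k0. a \<noteq> b \<longrightarrow> (\<exists>c<k0. S0 a c \<noteq> S0 b c)))"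
    and law_meas:
      "\<forall>n x. {w \<in> space M. \<forall>i j. i < j \<and> j < n \<longrightarrow> X n w i j = x i j} \<in> sets M"
    and law:
      "\<forall>n x. measure M {w \<in> space M. \<forall>i j. i < j \<and> j < n \<longrightarrow> X n w i j = x i j}
              = sbm_prob n k0 \<pi>0 (Pn n) x"
    and "0 < \<epsilon>"
  shows "AE w in M. eventually (\<lambda>n. k_KT \<epsilon> n (X n w) = k0) sequentially"
proof -
  interpret prob_space M by fact
  \<comment> \<open>The dense regime is the case \<open>\<rho> = 1\<close>.\<close>
  have "\<exists>S \<rho>. (\<forall>n. Pn n = (\<lambda>a b. \<rho> n * S a b)) \<and> (\<forall>n. 0 < \<rho> n)
      \<and> filterlim (\<lambda>n. real n * \<rho> n) at_top sequentially
      \<and> (\<forall>a<k0. \<forall>b<k0. 0 \<le> S a b \<and> S a b = S b a)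
      \<and> (\<forall>n. \<forall>a<k0. \<forall>b<k0. \<rho> n * S a b \<le> 1)
      \<and> (\<forall>a<k0. \<forall>b<k0. a \<noteq> b \<longrightarrow> (\<exists>c<k0. S a c \<noteq> S b c))"
    using regime
  proof
    assume "\<exists>P0. (\<forall>n. Pn n = P0)
             \<and> (\<forall>a<k0. \<forall>b<k0. 0 \<le> P0 a b \<and> P0 a b \<le> 1 \<and> P0 a b = P0 b a)
             \<and> (\<forall>a<k0. \<forall>b<k0. a \<noteq> b \<longrightarrow> (\<exists>c<k0. P0 a c \<noteq> P0 b c))"
    then obtain P0 where "\<forall>n. Pn n = P0"
      "\<forall>a<k0. \<forall>b<k0. 0 \<le> P0 a b \<and> P0 a b \<le> 1 \<and> P0 a b = P0 b a"
      "\<forall>a<k0. \<forall>b<k0. a \<noteq> b \<longrightarrow> (\<exists>c<k0. P0 a c \<noteq> P0 b c)" by blast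
    thus ?thesis using filterlim_real_sequentially
      by (intro exI[of _ P0] exI[of _ "\<lambda>_. 1"]) simp
  qed blast
  then obtain S \<rho> where S: "\<And>n. Pn n = (\<lambda>a b. \<rho> n * S a b)" "\<And>n. 0 < \<rho> n"
    "filterlim (\<lambda>n. real n * \<rho> n) at_top sequentially"
    "\<forall>a<k0. \<forall>b<k0. 0 \<le> S a b \<and> S a b = S b a"
    "\<forall>n. \<forall>a<k0. \<forall>b<k0. \<rho> n * S a b \<le> 1"
    "\<forall>a<k0. \<forall>b<k0. a \<noteq> b \<longrightarrow> (\<exists>c<k0. S a c \<noteq> S b c)" by blast
  obtain r where r: "summable r" "eventually (\<lambda>n.
    (\<Sum>A\<in>{A \<in> Pow (node_pairs n). k_KT \<epsilon> n (network A) \<noteq> k0}. sbm_prob n k0 \<pi>0 (Pn n) (network A)) \<le> r n) sequentially"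
    unfolding S(1) by (rule wrong_order_networks_sum[OF assms(2-4) S(2-6) assms(8)])
  define bad where "bad n = {w \<in> space M. k_KT \<epsilon> n (X n w) \<noteq> k0}" for n
  have bad: "bad n \<in> sets M" "measure M (bad n) =
    (\<Sum>A\<in>{A \<in> Pow (node_pairs n). k_KT \<epsilon> n (network A) \<noteq> k0}. sbm_prob n k0 \<pi>0 (Pn n) (network A))" for n
    unfolding bad_def
    using measure_network_event[OF assms(1) spec[OF law_meas] spec[OF law],
      where Q = "\<lambda>x. k_KT \<epsilon> n x \<noteq> k0"] by (simp_all only: k_KT_network_edge_set)
  have "summable (\<lambda>n. measure M (bad n))"
  \<comment> \<open>A bound valid for large \<open>n\<close> is enough, since finitely many terms do
    not affect summability.\<close>
  proof (rule summable_comparison_test_ev[OF _ r(1)])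
    show "eventually (\<lambda>n. norm (measure M (bad n)) \<le> r n) sequentially"
      using r(2) unfolding bad(2)[symmetric] by simp
  qed
  hence "AE w in M. eventually (\<lambda>n. w \<in> space M - bad n) sequentially"
    using bad(1) by (intro borel_cantelli_AE1) (auto simp: emeasure_eq_measure)
  thus ?thesis by (rule AE_mp) (auto simp: bad_def elim!: eventually_mono)
qed

end
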